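(* Let $m\ge2$ be an integer, let $X=(X_1,X_2)$ be a random vector in $\mathbb{R}^2$ with $\mathbb{E}[X_i]=0$, $\mathbb{E}[X_iX_j]=\delta_{ij}$ for $i,j\in\{1,2\}$ and $\mathbb{E}|X|^m<\infty$, and let $S(n)=X(1)+\dots+X(n)$, where $X(1),X(2),\dots$ are independent copies of $X$. Assume that there is a two-dimensional lattice $R\subset\mathbb{R}^2$ with $\mathbb{P}(S(n)\in R\text{ for all }n)=1$ and that, for every $x\in R\cap K_{\pi/m}$, almost surely $x+S(\tau_x)\in\partial K_{\pi/m}$. Let $h$ be the harmonic polynomial and $V$ the harmonic function described in the context. Then $$h(x)=V(x)\quad\text{for all }x\in K_{\pi/m}\cap R.$$ In particular, $h(x)\ge0$ for all $x\in K_{\pi/m}\cap R$.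
   Context: $K_{\pi/m}:=\{(r\cos\varphi,r\sin\varphi):r>0,\ 0<\varphi<\pi/m\}$; for $x\in K_{\pi/m}$, $\tau_x:=\inf\{n\ge1:x+S(n)\notin K_{\pi/m}\}$ and $\delta(x)$ is the distance from $x$ to $\partial K_{\pi/m}$. $u_{\pi/m}(x_1,x_2):=\Im\,(x_1+ix_2)^m$, a homogeneous polynomial of degree $m$. A function $f$ is harmonic for $S(n)$ killed at leaving $K_{\pi/m}$ if $f(x)=\mathbb{E}[f(x+X);\,x+X\in K_{\pi/m}]$ for all $x\in K_{\pi/m}\cap R$. The polynomial $h$: it is the (unique) polynomial of the form $h=u_{\pi/m}+r_m$, with $r_m$ a polynomial of degree at most $m-1$, such that $\mathbb{E}[h(x+X)]=h(x)$ for all $x\in\mathbb{R}^2$ and $h=0$ on $\partial K_{\pi/m}$; under the stated hypotheses it is harmonic for $S(n)$ killed at leaving $K_{\pi/m}$. The function $V$: it is the non-negative harmonic function for $S(n)$ killed at leaving $K_{\pi/m}$ constructed in the literature (Denisov–Wachtel). It is characterized by the following properties: $V:K_{\pi/m}\cap R\to[0,\infty)$ is harmonic for $S(n)$ killed at leaving $K_{\pi/m}$; $V(x)/u_{\pi/m}(x)\to1$ as $\delta(x)\to\infty$, $x\in K_{\pi/m}\cap R$; and there is a constant $\varkappa>0$ not depending on $x$ such that $\lim_{n\to\infty}n^{m/2}\,\mathbb{P}(\tau_x>n)=\varkappa V(x)$ for every $x\in K_{\pi/m}\cap R$. *)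

theory Defs
  imports "HOL-Probability.Probability"
begin

definition wedge :: "real \<Rightarrow> (real^2) set" where
  "wedge \<alpha> = {vector [r * cos \<phi>, r * sin \<phi>] | r \<phi>. r > 0 \<and> 0 < \<phi> \<and> \<phi> < \<alpha>}"

definition wedge_harmonic :: "nat \<Rightarrow> real^2 \<Rightarrow> real" where
  "wedge_harmonic m x = Im (Complex (x $ 1) (x $ 2) ^ m)"

text \<open>Real polynomial functions in two variables of total degree at most \<open>d\<close>.\<close>

definition poly2_deg_le :: "nat \<Rightarrow> (real^2 \<Rightarrow> real) \<Rightarrow> bool" where
  "poly2_deg_le d p \<longleftrightarrow>
     (\<exists>c :: nat \<Rightarrow> nat \<Rightarrow> real. \<forall>x. p x = (\<Sum>i\<le>d. \<Sum>j\<le>d - i. c i j * (x $ 1) ^ i * (x $ 2) ^ j))"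

definition lattice2 :: "(real^2) set \<Rightarrow> bool" where
  "lattice2 R \<longleftrightarrow>
     (\<exists>v w. v \<noteq> w \<and> independent {v, w} \<and>
            R = {of_int a *\<^sub>R v + of_int b *\<^sub>R w | a b. True})"

definition walk :: "(nat \<Rightarrow> 'a \<Rightarrow> real^2) \<Rightarrow> nat \<Rightarrow> 'a \<Rightarrow> real^2" where
  "walk \<xi> n \<omega> = (\<Sum>k = 1..n. \<xi> k \<omega>)"

definition exit_time ::
    "(real^2) set \<Rightarrow> (nat \<Rightarrow> 'a \<Rightarrow> real^2) \<Rightarrow> real^2 \<Rightarrow> 'a \<Rightarrow> enat" where
  "exit_time K \<xi> x \<omega> = Inf {enat n | n. n \<ge> 1 \<and> x + walk \<xi> n \<omega> \<notin> K}"

text \<open>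
  Functions that are harmonic for the killed walk are defined on \<open>K \<inter> R\<close> only. They are
  represented by total functions whose values elsewhere are irrelevant; accordingly the
  expectation is restricted to \<open>x + X \<in> K \<inter> R\<close>, which agrees with \<open>x + X \<in> K\<close> almost surely
  because \<open>X\<close> takes values in \<open>R\<close> almost surely. Integrability is explicit since the Bochner
  integral of a non-integrable function is \<open>0\<close>.
\<close>

definition killed_harmonic ::
    "'a measure \<Rightarrow> ('a \<Rightarrow> real^2) \<Rightarrow> (real^2) set \<Rightarrow> (real^2) set \<Rightarrow> (real^2 \<Rightarrow> real) \<Rightarrow> bool" where
  "killed_harmonic M X K R f \<longleftrightarrow>
     (\<forall>x\<in>K \<inter> R.
        integrable M (\<lambda>\<omega>. indicat_real (K \<inter> R) (x + X \<omega>) * f (x + X \<omega>)) \<and>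
        f x = (\<integral>\<omega>. indicat_real (K \<inter> R) (x + X \<omega>) * f (x + X \<omega>) \<partial>M))"

definition harmonic_polynomial ::
    "'a measure \<Rightarrow> ('a \<Rightarrow> real^2) \<Rightarrow> nat \<Rightarrow> (real^2 \<Rightarrow> real) \<Rightarrow> bool" where
  "harmonic_polynomial M X m h \<longleftrightarrow>
     (\<exists>r. poly2_deg_le (m - 1) r \<and> (\<forall>x. h x = wedge_harmonic m x + r x)) \<and>
     (\<forall>x. (\<integral>\<omega>. h (x + X \<omega>) \<partial>M) = h x) \<and>
     (\<forall>x \<in> frontier (wedge (pi / real m)). h x = 0)"

text \<open>
  The filter below is the limit \<open>dist (x, frontier K) \<rightarrow> \<infinity>\<close> along \<open>x \<in> K \<inter> R\<close>.
\<close>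

definition killed_walk_V ::
    "'a measure \<Rightarrow> ('a \<Rightarrow> real^2) \<Rightarrow> (nat \<Rightarrow> 'a \<Rightarrow> real^2) \<Rightarrow> nat \<Rightarrow> (real^2) set \<Rightarrow>
     (real^2 \<Rightarrow> real) \<Rightarrow> bool" where
  "killed_walk_V M X \<xi> m R V \<longleftrightarrow>
     (let K = wedge (pi / real m) in
       (\<forall>x\<in>K \<inter> R. V x \<ge> 0) \<and>
       killed_harmonic M X K R V \<and>
       ((\<lambda>x. V x / wedge_harmonic m x) \<longlongrightarrow> 1)
         (inf (filtercomap (\<lambda>x. infdist x (frontier K)) at_top) (principal (K \<inter> R))) \<and>
       (\<exists>\<kappa>>0. \<forall>x\<in>K \<inter> R.
         (\<lambda>n. real n powr (real m / 2) *
                measure M {\<omega> \<in> space M. exit_time K \<xi> x \<omega> > enat n}) \<longlonglongrightarrow> \<kappa> * V x))"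

end

theory Submission
  imports Defs
begin

text \<open>
  Write \<open>u\<close> for the harmonic function \<open>wedge_harmonic m\<close> of the wedge \<open>K\<close>. The polynomial \<open>h\<close> is itself harmonic
  for the killed walk: it has the mean value property in the whole plane, and since the walk leaves
  \<open>K\<close> through the boundary, where \<open>h\<close> vanishes, nothing is lost when the expectation is restricted to
  \<open>K\<close> (\<open>harmonic_polynomial_killed_harmonic\<close>). So \<open>D = h - V\<close> is harmonic for the killed walk, and the
  theorem is a uniqueness statement: \<open>D\<close> is zero because it is of smaller order than \<open>V\<close>.

  At large distance from the boundary this order is immediate: \<open>V\<close> is asymptotic to \<open>u\<close> by assumption, and
  \<open>h - u\<close> has degree at most \<open>m - 1\<close>, while \<open>u\<close> is comparable to the depth of the point times its norm to
  the power \<open>m - 1\<close> (\<open>wedge_harmonic_bounds\<close>). The difficulty is a strip along the boundary, where the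
  asymptotics of \<open>V\<close> say nothing and \<open>h\<close> and \<open>V\<close> are of the same order. There harmonicity has to help. As
  \<open>X\<close> is centred with identity covariance and lives on a lattice, it has atoms on both sides of every
  line through the origin, so that from any point of the strip far from the apex one step of
  probability bounded below leads deeper into \<open>K\<close>, and one such step leads to the point from
  a deeper one (\<open>inward_steps\<close>). Passing through finitely many layers of the strip yields a Harnack
  inequality, so \<open>V\<close> has order \<open>(1 + depth) * norm ^ (m - 1)\<close> everywhere far out
  (\<open>harmonic_lower_growth\<close>, \<open>harmonic_upper_growth\<close>). Let \<open>b\<close> be the upper limit of \<open>\<bar>D\<bar> / V\<close> at infinity. It
  is finite by the growth bounds. If \<open>b\<close> were positive, the mean value property would spread the smallness of
  the ratio at large depth through the layers, and \<open>b\<close> could be lowered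
  (\<open>harmonic_ratio_improvement\<close>). Hence \<open>b = 0\<close>.

  It remains to pass from smallness at infinity to zero. For every \<open>e > 0\<close> the subharmonic function
  \<open>\<bar>D\<bar> - e * V\<close> is positive at finitely many lattice points only. At a positive maximum it would have to
  be constant along every possible step, which would take the walk out of any finite set
  (\<open>harmonic_eq_zero\<close>). So \<open>\<bar>D\<bar> \<le> e * V\<close> for all \<open>e > 0\<close>, and \<open>h = V \<ge> 0\<close>.
\<close>

section \<open>Harmonic functions for a walk killed on leaving a domain\<close>

text \<open>
  The state space is \<open>K \<inter> R\<close>, and \<open>d\<close> stands for the distance to the boundary of \<open>K\<close>. Far from the
  origin, a point at depth below a given level can be left along one single step that occurs with
  probability at least \<open>p\<close>, has length at most \<open>L\<close> and gains depth \<open>t\<close>; and it can be reached by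
  such a step from a point that is deeper by \<open>t\<close>. Both directions are needed: the first propagates
  lower bounds for harmonic functions from the deep region towards the boundary, the second upper
  bounds. The threshold on \<open>norm x\<close> depends on the level because a point near the apex of a wedge is
  close to both sides, so that moving away from one of them may mean approaching the other.
\<close>

locale layered_walk = prob_space M
  for M :: "'a measure" +
  fixes X :: "'a \<Rightarrow> real^2" and K R :: "(real^2) set" and d :: "real^2 \<Rightarrow> real" and p t L :: real
  assumes X_measurable [measurable]: "X \<in> borel_measurable M"
    and finite_ball: "\<And>B. finite {x \<in> K \<inter> R. norm x < B}"
    and p_pos: "0 < p" and t_pos: "0 < t" and L_pos: "0 < L"
    and d_nonneg: "\<And>x. x \<in> K \<inter> R \<Longrightarrow> 0 \<le> d x"
    and d_lipschitz: "\<And>x y. d y \<le> d x + norm (y - x)"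
    and step_forward: "\<And>A. \<exists>B. \<forall>x\<in>K \<inter> R. B \<le> norm x \<longrightarrow> d x < A \<longrightarrow>
          (\<exists>s. p \<le> prob {\<omega> \<in> space M. X \<omega> = s} \<and> norm s \<le> L \<and>
               x + s \<in> K \<inter> R \<and> d x + t \<le> d (x + s))"
    and step_backward: "\<And>A. \<exists>B. \<forall>x\<in>K \<inter> R. B \<le> norm x \<longrightarrow> d x < A \<longrightarrow>
          (\<exists>s. p \<le> prob {\<omega> \<in> space M. X \<omega> = s} \<and> norm s \<le> L \<and>
               x - s \<in> K \<inter> R \<and> d x + t \<le> d (x - s))"
begin

abbreviation far :: "(real^2) filter" where
  "far \<equiv> inf at_infinity (principal (K \<inter> R))"

lemma eventually_far:
  "eventually P far \<longleftrightarrow> (\<exists>B. \<forall>x\<in>K \<inter> R. B \<le> norm x \<longrightarrow> P x)"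
  unfolding eventually_inf_principal eventually_at_infinity by blast

lemma eventually_far_state: "eventually (\<lambda>x. x \<in> K \<inter> R \<and> B \<le> norm x) far"
  unfolding eventually_far by auto

lemma eventually_far_nearby:
  assumes "eventually P far"
  shows "eventually (\<lambda>x. \<forall>y\<in>K \<inter> R. norm (y - x) \<le> L \<longrightarrow> P y) far"
proof -
  obtain B where B: "\<forall>x\<in>K \<inter> R. B \<le> norm x \<longrightarrow> P x"
    using assms unfolding eventually_far by blast
  have "P y" if "y \<in> K \<inter> R" "norm (y - x) \<le> L" "B + L \<le> norm x" for x y
  proof -
    have "norm x \<le> norm y + norm (y - x)"
      by (metis norm_minus_commute norm_triangle_sub)
    then show ?thesis using B that by force
  qed
  then show ?thesis unfolding eventually_far by blast
qed

text \<open>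
  Only finitely many states lie in a ball, so an asymptotic bound becomes a bound on the whole state
  space at the price of an additive constant. This lets asymptotic bounds be inserted into
  expectations, where the next state ranges over all of \<open>K \<inter> R\<close>.
\<close>

lemma far_bound_imp_affine_bound:
  fixes f g :: "real^2 \<Rightarrow> real"
  assumes "eventually (\<lambda>x. f x \<le> g x) far"
  obtains C where "0 \<le> C" "\<And>x. x \<in> K \<inter> R \<Longrightarrow> f x \<le> g x + C"
proof -
  obtain B where B: "\<forall>x\<in>K \<inter> R. B \<le> norm x \<longrightarrow> f x \<le> g x"
    using assms unfolding eventually_far by blast
  define S where "S = {x \<in> K \<inter> R. norm x < B}"
  have S: "finite S" unfolding S_def by (rule finite_ball)
  define C where "C = (\<Sum>x\<in>S. \<bar>f x - g x\<bar>)"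
  have "f x \<le> g x + C" if "x \<in> K \<inter> R" for x
  proof (cases "norm x < B")
    case True
    then have "\<bar>f x - g x\<bar> \<le> C"
      unfolding C_def using S that by (intro member_le_sum) (auto simp: S_def)
    then show ?thesis by linarith
  next
    case False
    moreover have "0 \<le> C" unfolding C_def by (simp add: sum_nonneg)
    ultimately show ?thesis using B that by force
  qed
  moreover have "0 \<le> C" unfolding C_def by (simp add: sum_nonneg)
  ultimately show ?thesis using that by blast
qed

lemma atom_le_integral:
  assumes int: "integrable M (\<lambda>\<omega>. \<phi> (X \<omega>))" and nonneg: "\<And>z. (0::real) \<le> \<phi> z"
  shows "prob {\<omega> \<in> space M. X \<omega> = s} * \<phi> s \<le> (\<integral>\<omega>. \<phi> (X \<omega>) \<partial>M)"
proof -
  let ?A = "{\<omega> \<in> space M. X \<omega> = s}"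
  have A: "?A \<in> sets M" by measurable
  have "prob ?A * \<phi> s = (\<integral>\<omega>. indicat_real ?A \<omega> * \<phi> s \<partial>M)"
    using A by (simp add: emeasure_eq_measure)
  also have "\<dots> \<le> (\<integral>\<omega>. \<phi> (X \<omega>) \<partial>M)"
  proof (rule integral_mono)
    show "integrable M (\<lambda>\<omega>. indicat_real ?A \<omega> * \<phi> s)"
      using A by (intro integrable_mult_left integrable_real_indicator) (auto simp: emeasure_eq_measure)
    show "indicat_real ?A \<omega> * \<phi> s \<le> \<phi> (X \<omega>)" for \<omega>
      using nonneg by (auto simp: indicator_def)
  qed (rule int)
  finally show ?thesis .
qed

lemma harmonic_ge_atom:
  assumes harm: "killed_harmonic M X K R f" and nonneg: "\<And>x. x \<in> K \<inter> R \<Longrightarrow> 0 \<le> f x"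
    and x: "x \<in> K \<inter> R" "x + s \<in> K \<inter> R" and s: "p \<le> prob {\<omega> \<in> space M. X \<omega> = s}"
  shows "p * f (x + s) \<le> f x"
proof -
  let ?\<phi> = "\<lambda>z. indicat_real (K \<inter> R) (x + z) * f (x + z)"
  have "p * f (x + s) \<le> prob {\<omega> \<in> space M. X \<omega> = s} * ?\<phi> s"
    using s nonneg[OF x(2)] x(2) by (simp add: mult_right_mono)
  also have "\<dots> \<le> (\<integral>\<omega>. ?\<phi> (X \<omega>) \<partial>M)"
    using harm x(1) nonneg unfolding killed_harmonic_def
    by (intro atom_le_integral) (auto simp: indicator_def)
  also have "\<dots> = f x"
    using harm x(1) unfolding killed_harmonic_def by simp
  finally show ?thesis .
qed

lemma harmonic_abs_le:
  assumes "killed_harmonic M X K R D" "x \<in> K \<inter> R"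
  shows "integrable M (\<lambda>\<omega>. indicat_real (K \<inter> R) (x + X \<omega>) * \<bar>D (x + X \<omega>)\<bar>)"
    and "\<bar>D x\<bar> \<le> (\<integral>\<omega>. indicat_real (K \<inter> R) (x + X \<omega>) * \<bar>D (x + X \<omega>)\<bar> \<partial>M)"
proof -
  let ?g = "\<lambda>\<omega>. indicat_real (K \<inter> R) (x + X \<omega>) * D (x + X \<omega>)"
  have g: "integrable M ?g" "D x = (\<integral>\<omega>. ?g \<omega> \<partial>M)"
    using assms unfolding killed_harmonic_def by auto
  have eq: "\<bar>?g \<omega>\<bar> = indicat_real (K \<inter> R) (x + X \<omega>) * \<bar>D (x + X \<omega>)\<bar>" for \<omega>
    by (simp add: abs_mult)
  show "integrable M (\<lambda>\<omega>. indicat_real (K \<inter> R) (x + X \<omega>) * \<bar>D (x + X \<omega>)\<bar>)"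
    using integrable_abs[OF g(1)] unfolding eq .
  show "\<bar>D x\<bar> \<le> (\<integral>\<omega>. indicat_real (K \<inter> R) (x + X \<omega>) * \<bar>D (x + X \<omega>)\<bar> \<partial>M)"
    unfolding g(2) using integral_abs_bound[of M ?g] unfolding eq .
qed

text \<open>
  A property that holds at depth at least \<open>A\<close> is carried to the boundary in finitely many layers of
  thickness \<open>t\<close>, because \<open>d\<close> is non-negative. The real parameter of \<open>G\<close> is the constant in an estimate:
  it may shrink from layer to layer, which is harmless since the number of layers is fixed.
\<close>

lemma layer_induct:
  fixes G :: "real \<Rightarrow> real^2 \<Rightarrow> bool"
  assumes base: "\<exists>c>0. eventually (\<lambda>x. A \<le> d x \<longrightarrow> G c x) far"
    and mono: "\<And>c c' x. 0 < c' \<Longrightarrow> c' \<le> c \<Longrightarrow> G c x \<Longrightarrow> G c' x"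
    and step: "\<And>c. 0 < c \<Longrightarrow> \<exists>c'>0. eventually (\<lambda>x. d x < A \<longrightarrow>
                 (\<forall>y\<in>K \<inter> R. norm (y - x) \<le> L \<longrightarrow> d x + t \<le> d y \<longrightarrow> G c y) \<longrightarrow> G c' x) far"
  shows "\<exists>c>0. eventually (G c) far"
proof -
  have layers: "\<exists>c>0. eventually (\<lambda>x. A - real k * t \<le> d x \<longrightarrow> G c x) far" for k
  proof (induction k)
    case 0
    then show ?case using base by simp
  next
    case (Suc k)
    then obtain c where c: "0 < c" "eventually (\<lambda>x. A - real k * t \<le> d x \<longrightarrow> G c x) far"
      by blast
    obtain c' where c': "0 < c'" "eventually (\<lambda>x. d x < A \<longrightarrow>
        (\<forall>y\<in>K \<inter> R. norm (y - x) \<le> L \<longrightarrow> d x + t \<le> d y \<longrightarrow> G c y) \<longrightarrow> G c' x) far"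
      using step[OF c(1)] by blast
    have "eventually (\<lambda>x. A - real (Suc k) * t \<le> d x \<longrightarrow> G (min c c') x) far"
      using eventually_far_nearby[OF c(2)] c(2) c'(2)
    proof eventually_elim
      case (elim x)
      show ?case
      proof
        assume low: "A - real (Suc k) * t \<le> d x"
        show "G (min c c') x"
        proof (cases "d x < A")
          case True
          have "G c y" if "y \<in> K \<inter> R" "norm (y - x) \<le> L" "d x + t \<le> d y" for y
            using elim(1) that low by (auto simp: algebra_simps)
          then have "G c' x" using elim(3) True by blast
          then show ?thesis using c(1) c'(1) by (intro mono[of "min c c'" c']) auto
        next
          case False
          have "0 \<le> real k * t" using t_pos by simp
          then have "G c x" using elim(2) False by linarith
          then show ?thesis using c(1) c'(1) by (intro mono[of "min c c'" c]) auto
        qed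
      qed
    qed
    then show ?case using c(1) c'(1) by (intro exI[of _ "min c c'"]) auto
  qed
  obtain k where k: "A < real k * t"
    using t_pos reals_Archimedean3 by blast
  obtain c where c: "0 < c" "eventually (\<lambda>x. A - real k * t \<le> d x \<longrightarrow> G c x) far"
    using layers by blast
  have "eventually (G c) far"
    using c(2) eventually_far_state[of 0]
  proof eventually_elim
    case (elim x)
    then show ?case using d_nonneg[of x] k by auto
  qed
  then show ?thesis using c(1) by blast
qed

text \<open>
  The order of magnitude of \<open>u\<close> at depth at least 1, where \<open>n\<close> is the degree of \<open>u\<close> minus 1. Adding 1 to
  the depth keeps it comparable at neighbouring points also when one of them is close to the boundary.
\<close>

definition growth :: "nat \<Rightarrow> real^2 \<Rightarrow> real" where
  "growth n x = (1 + d x) * norm x ^ n"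

lemma growth_nonneg: "x \<in> K \<inter> R \<Longrightarrow> 0 \<le> growth n x"
  using d_nonneg unfolding growth_def by simp

lemma growth_inward:
  assumes "x \<in> K \<inter> R" "norm (y - x) \<le> L" "d x \<le> d y" "2 * L \<le> norm x"
  shows "growth n x \<le> 2 ^ n * growth n y"
    and "growth n y \<le> 2 ^ n * (1 + L) * growth n x"
proof -
  have dx: "0 \<le> d x" using d_nonneg assms(1) by blast
  have xy: "norm x \<le> 2 * norm y"
    using norm_triangle_sub[of x y] assms(2,4) by (simp add: norm_minus_commute)
  have yx: "norm y \<le> 2 * norm x"
    using norm_triangle_sub[of y x] assms(2,4) L_pos by simp
  have "norm x ^ n \<le> 2 ^ n * norm y ^ n"
    using power_mono[OF xy, of n] by (simp add: power_mult_distrib)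
  then have "(1 + d x) * norm x ^ n \<le> (1 + d y) * (2 ^ n * norm y ^ n)"
    using dx assms(3) by (intro mult_mono) auto
  then show "growth n x \<le> 2 ^ n * growth n y" unfolding growth_def by (simp add: algebra_simps)
  have "norm y ^ n \<le> 2 ^ n * norm x ^ n"
    using power_mono[OF yx, of n] by (simp add: power_mult_distrib)
  moreover have "1 + d y \<le> (1 + L) * (1 + d x)"
  proof -
    have "1 + d y \<le> 1 + d x + L" using d_lipschitz[of y x] assms(2) by linarith
    also have "\<dots> \<le> (1 + L) * (1 + d x)" using dx L_pos by (simp add: algebra_simps)
    finally show ?thesis .
  qed
  ultimately have "(1 + d y) * norm y ^ n \<le> ((1 + L) * (1 + d x)) * (2 ^ n * norm x ^ n)"
    using dx assms(3) L_pos by (intro mult_mono) auto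
  then show "growth n y \<le> 2 ^ n * (1 + L) * growth n x"
    unfolding growth_def by (simp add: algebra_simps)
qed

text \<open>
  In each layer, a step that goes deeper gives \<open>V x \<ge> p * V (x + s)\<close> by harmonicity and \<open>V \<ge> 0\<close>.
\<close>

lemma harmonic_lower_growth:
  assumes harm: "killed_harmonic M X K R V" and nonneg: "\<And>x. x \<in> K \<inter> R \<Longrightarrow> 0 \<le> V x"
    and deep: "\<exists>c>0. eventually (\<lambda>x. A \<le> d x \<longrightarrow> c * growth n x \<le> V x) far"
  shows "\<exists>c>0. eventually (\<lambda>x. c * growth n x \<le> V x) far"
proof -
  have mono: "\<exists>c>0. eventually (\<lambda>x. x \<in> K \<inter> R \<longrightarrow> c * growth n x \<le> V x) far"
  proof (rule layer_induct)
    show "\<exists>c>0. \<forall>\<^sub>F x in far. A \<le> d x \<longrightarrow> x \<in> K \<inter> R \<longrightarrow> c * growth n x \<le> V x"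
      using deep by (auto elim!: eventually_mono)
  next
    fix c c' :: real and x
    assume "0 < c'" "c' \<le> c" "x \<in> K \<inter> R \<longrightarrow> c * growth n x \<le> V x"
    then show "x \<in> K \<inter> R \<longrightarrow> c' * growth n x \<le> V x"
      using growth_nonneg[of x n] mult_right_mono[of c' c "growth n x"] by auto
  next
    fix c :: real assume c: "0 < c"
    define c' where "c' = p * c / 2 ^ n"
    have c': "0 < c'" unfolding c'_def using c p_pos by simp
    have fwd: "eventually (\<lambda>x. d x < A \<longrightarrow> (\<exists>s. p \<le> prob {\<omega> \<in> space M. X \<omega> = s} \<and> norm s \<le> L \<and>
               x + s \<in> K \<inter> R \<and> d x + t \<le> d (x + s))) far"
      using step_forward[of A] unfolding eventually_far .
    have "eventually (\<lambda>x. d x < A \<longrightarrow> (\<forall>y\<in>K \<inter> R. norm (y - x) \<le> L \<longrightarrow> d x + t \<le> d y \<longrightarrow>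
            y \<in> K \<inter> R \<longrightarrow> c * growth n y \<le> V y) \<longrightarrow> x \<in> K \<inter> R \<longrightarrow> c' * growth n x \<le> V x) far"
      using fwd eventually_far_state[of "2 * L"]
    proof eventually_elim
      case (elim x)
      show ?case
      proof (intro impI)
        assume low: "d x < A" and IH: "\<forall>y\<in>K \<inter> R. norm (y - x) \<le> L \<longrightarrow> d x + t \<le> d y \<longrightarrow>
            y \<in> K \<inter> R \<longrightarrow> c * growth n y \<le> V y" and x: "x \<in> K \<inter> R"
        obtain s where s: "p \<le> prob {\<omega> \<in> space M. X \<omega> = s}" "norm s \<le> L"
               "x + s \<in> K \<inter> R" "d x + t \<le> d (x + s)"
          using elim(1) low by blast
        have "growth n x \<le> 2 ^ n * growth n (x + s)"
          using s(2,4) t_pos elim x by (intro growth_inward(1)) auto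
        then have "c' * growth n x \<le> c' * (2 ^ n * growth n (x + s))"
          using c' by (intro mult_left_mono) auto
        also have "\<dots> = p * (c * growth n (x + s))"
          unfolding c'_def by simp
        also have "\<dots> \<le> p * V (x + s)"
          using IH s p_pos by (intro mult_left_mono) auto
        also have "\<dots> \<le> V x"
          using harmonic_ge_atom[OF harm nonneg x s(3,1)] .
        finally show "c' * growth n x \<le> V x" .
      qed
    qed
    then show "\<exists>c'>0. \<forall>\<^sub>F x in far. d x < A \<longrightarrow> (\<forall>y\<in>K \<inter> R. norm (y - x) \<le> L \<longrightarrow> d x + t \<le> d y \<longrightarrow>
            y \<in> K \<inter> R \<longrightarrow> c * growth n y \<le> V y) \<longrightarrow> x \<in> K \<inter> R \<longrightarrow> c' * growth n x \<le> V x"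
      using c' by blast
  qed
  then show ?thesis
    unfolding eventually_far by auto
qed

text \<open>
  The mirror image of the previous bound: now \<open>x\<close> is reached from the deeper point \<open>x - s\<close>, so that
  \<open>p * V x \<le> V (x - s)\<close>.
\<close>

lemma harmonic_upper_growth:
  assumes harm: "killed_harmonic M X K R V" and nonneg: "\<And>x. x \<in> K \<inter> R \<Longrightarrow> 0 \<le> V x"
    and deep: "\<exists>c>0. eventually (\<lambda>x. A \<le> d x \<longrightarrow> c * V x \<le> growth n x) far"
  shows "\<exists>c>0. eventually (\<lambda>x. c * V x \<le> growth n x) far"
proof -
  have "\<exists>c>0. eventually (\<lambda>x. x \<in> K \<inter> R \<longrightarrow> c * V x \<le> growth n x) far"
  proof (rule layer_induct)
    show "\<exists>c>0. \<forall>\<^sub>F x in far. A \<le> d x \<longrightarrow> x \<in> K \<inter> R \<longrightarrow> c * V x \<le> growth n x"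
      using deep by (auto elim!: eventually_mono)
  next
    fix c c' :: real and x
    assume "0 < c'" "c' \<le> c" "x \<in> K \<inter> R \<longrightarrow> c * V x \<le> growth n x"
    then show "x \<in> K \<inter> R \<longrightarrow> c' * V x \<le> growth n x"
      using nonneg[of x] mult_right_mono[of c' c "V x"] by auto
  next
    fix c :: real assume c: "0 < c"
    define c' where "c' = p * c / (2 ^ n * (1 + L))"
    have c': "0 < c'" unfolding c'_def using c p_pos L_pos by simp
    have bwd: "eventually (\<lambda>x. d x < A \<longrightarrow> (\<exists>s. p \<le> prob {\<omega> \<in> space M. X \<omega> = s} \<and> norm s \<le> L \<and>
               x - s \<in> K \<inter> R \<and> d x + t \<le> d (x - s))) far"
      using step_backward[of A] unfolding eventually_far .
    have "eventually (\<lambda>x. d x < A \<longrightarrow> (\<forall>y\<in>K \<inter> R. norm (y - x) \<le> L \<longrightarrow> d x + t \<le> d y \<longrightarrow>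
            y \<in> K \<inter> R \<longrightarrow> c * V y \<le> growth n y) \<longrightarrow> x \<in> K \<inter> R \<longrightarrow> c' * V x \<le> growth n x) far"
      using bwd eventually_far_state[of "2 * L"]
    proof eventually_elim
      case (elim x)
      show ?case
      proof (intro impI)
        assume low: "d x < A" and IH: "\<forall>y\<in>K \<inter> R. norm (y - x) \<le> L \<longrightarrow> d x + t \<le> d y \<longrightarrow>
            y \<in> K \<inter> R \<longrightarrow> c * V y \<le> growth n y" and x: "x \<in> K \<inter> R"
        obtain s where s: "p \<le> prob {\<omega> \<in> space M. X \<omega> = s}" "norm s \<le> L"
               "x - s \<in> K \<inter> R" "d x + t \<le> d (x - s)"
          using elim(1) low by blast
        have g: "growth n (x - s) \<le> 2 ^ n * (1 + L) * growth n x"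
          using s(2,4) t_pos elim x by (intro growth_inward(2)) auto
        have "p * V x \<le> V (x - s)"
          using harmonic_ge_atom[OF harm nonneg s(3) _ s(1)] x by simp
        then have "c * (p * V x) \<le> c * V (x - s)"
          using c by (intro mult_left_mono) auto
        also have "\<dots> \<le> growth n (x - s)"
          using IH s by auto
        also note g
        finally have "p * c * V x \<le> growth n x * (2 ^ n * (1 + L))" by (simp add: mult_ac)
        moreover have "0 < 2 ^ n * (1 + L)" using L_pos by simp
        ultimately have "p * c * V x / (2 ^ n * (1 + L)) \<le> growth n x"
          by (simp add: pos_divide_le_eq)
        then show "c' * V x \<le> growth n x" unfolding c'_def by simp
      qed
    qed
    then show "\<exists>c'>0. \<forall>\<^sub>F x in far. d x < A \<longrightarrow> (\<forall>y\<in>K \<inter> R. norm (y - x) \<le> L \<longrightarrow> d x + t \<le> d y \<longrightarrow>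
            y \<in> K \<inter> R \<longrightarrow> c * V y \<le> growth n y) \<longrightarrow> x \<in> K \<inter> R \<longrightarrow> c' * V x \<le> growth n x"
      using c' by blast
  qed
  then show ?thesis
    unfolding eventually_far by auto
qed

text \<open>
  If \<open>b > 0\<close> bounds the upper limit of \<open>\<bar>D\<bar> / V\<close> at infinity, then it is not sharp. At large depth the ratio is
  at most \<open>b / 2\<close>. At \<open>x\<close> in a lower layer, \<open>\<bar>D x\<bar>\<close> is at most the mean of \<open>\<bar>D\<bar>\<close> after one step; on
  one atom, which carries a fixed proportion \<open>p * \<eta>\<close> of \<open>V x\<close>, the ratio is smaller than \<open>b\<close> by a
  definite amount, and elsewhere it is at most \<open>b + e\<close> for an \<open>e\<close> of free choice, up to an additive
  constant that is negligible against \<open>V x\<close>. So the gain survives, with a smaller constant.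
\<close>

lemma harmonic_ratio_improvement:
  assumes V: "killed_harmonic M X K R V" "\<And>x. x \<in> K \<inter> R \<Longrightarrow> 0 \<le> V x"
    and D: "killed_harmonic M X K R D"
    and harnack: "0 < \<eta>" "eventually (\<lambda>x. \<forall>y\<in>K \<inter> R. norm (y - x) \<le> L \<longrightarrow> d x + t \<le> d y \<longrightarrow> \<eta> * V x \<le> V y) far"
    and large: "\<And>B. eventually (\<lambda>x. B \<le> V x) far"
    and deep: "\<And>e. 0 < e \<Longrightarrow> \<exists>A. eventually (\<lambda>x. A \<le> d x \<longrightarrow> \<bar>D x\<bar> \<le> e * V x) far"
    and b: "0 < b" "\<And>e. 0 < e \<Longrightarrow> eventually (\<lambda>x. \<bar>D x\<bar> \<le> (b + e) * V x) far"
  shows "\<exists>c>0. eventually (\<lambda>x. \<bar>D x\<bar> \<le> (b - c) * V x) far"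
proof -
  obtain A where A: "eventually (\<lambda>x. A \<le> d x \<longrightarrow> \<bar>D x\<bar> \<le> (b / 2) * V x) far"
    using deep[of "b / 2"] b(1) by auto
  have "\<exists>c>0. eventually (\<lambda>x. x \<in> K \<inter> R \<longrightarrow> \<bar>D x\<bar> \<le> (b - c) * V x) far"
  proof (rule layer_induct)
    have "eventually (\<lambda>x. A \<le> d x \<longrightarrow> x \<in> K \<inter> R \<longrightarrow> \<bar>D x\<bar> \<le> (b - b / 2) * V x) far"
      using A by (auto elim!: eventually_mono)
    then show "\<exists>c>0. \<forall>\<^sub>F x in far. A \<le> d x \<longrightarrow> x \<in> K \<inter> R \<longrightarrow> \<bar>D x\<bar> \<le> (b - c) * V x"
      using b(1) by (intro exI[of _ "b / 2"]) auto
  next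
    fix c c' :: real and x
    assume "0 < c'" "c' \<le> c" "x \<in> K \<inter> R \<longrightarrow> \<bar>D x\<bar> \<le> (b - c) * V x"
    then show "x \<in> K \<inter> R \<longrightarrow> \<bar>D x\<bar> \<le> (b - c') * V x"
      using V(2)[of x] mult_right_mono[of "b - c" "b - c'" "V x"] by auto
  next
    fix c :: real assume c: "0 < c"
    \<comment> \<open>The atom gains \<open>3 * e * V x\<close>; one third pays for the excess of \<open>b + e\<close> over \<open>b\<close>, one for \<open>C\<close>, one remains.\<close>
    define e where "e = p * c * \<eta> / 3"
    have e: "0 < e" unfolding e_def using c p_pos harnack(1) by simp
    obtain C where C: "0 \<le> C" "\<And>x. x \<in> K \<inter> R \<Longrightarrow> \<bar>D x\<bar> \<le> (b + e) * V x + C"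
      using far_bound_imp_affine_bound[OF b(2)[OF e]] by blast
    have fwd: "eventually (\<lambda>x. d x < A \<longrightarrow> (\<exists>s. p \<le> prob {\<omega> \<in> space M. X \<omega> = s} \<and> norm s \<le> L \<and>
               x + s \<in> K \<inter> R \<and> d x + t \<le> d (x + s))) far"
      using step_forward[of A] unfolding eventually_far .
    have "eventually (\<lambda>x. d x < A \<longrightarrow> (\<forall>y\<in>K \<inter> R. norm (y - x) \<le> L \<longrightarrow> d x + t \<le> d y \<longrightarrow>
            y \<in> K \<inter> R \<longrightarrow> \<bar>D y\<bar> \<le> (b - c) * V y) \<longrightarrow> x \<in> K \<inter> R \<longrightarrow> \<bar>D x\<bar> \<le> (b - e) * V x) far"
      using fwd harnack(2) large[of "C / e"]
    proof eventually_elim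
      case (elim x)
      show ?case
      proof (intro impI)
        assume low: "d x < A" and IH: "\<forall>y\<in>K \<inter> R. norm (y - x) \<le> L \<longrightarrow> d x + t \<le> d y \<longrightarrow>
            y \<in> K \<inter> R \<longrightarrow> \<bar>D y\<bar> \<le> (b - c) * V y" and x: "x \<in> K \<inter> R"
        obtain s where s: "p \<le> prob {\<omega> \<in> space M. X \<omega> = s}" "norm s \<le> L"
               "x + s \<in> K \<inter> R" "d x + t \<le> d (x + s)"
          using elim(1) low by blast
        have Dy: "\<bar>D (x + s)\<bar> \<le> (b - c) * V (x + s)" using IH s by auto
        have Vy: "\<eta> * V x \<le> V (x + s)" using elim(2) s by auto
        have Vy0: "0 \<le> V (x + s)" using V(2) s by blast
        define I where "I z = indicat_real (K \<inter> R) (x + z)" for z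
        \<comment> \<open>The slack in the bound for \<open>\<bar>D\<bar>\<close>, as a non-negative function of the step.\<close>
        define \<phi> where "\<phi> z = (b + e) * (I z * V (x + z)) + C - I z * \<bar>D (x + z)\<bar>" for z
        have \<phi>0: "0 \<le> \<phi> z" for z
          using C(1) C(2)[of "x + z"] unfolding \<phi>_def I_def by (auto simp: indicator_def)
        have intV: "integrable M (\<lambda>\<omega>. I (X \<omega>) * V (x + X \<omega>))"
          and eqV: "(\<integral>\<omega>. I (X \<omega>) * V (x + X \<omega>) \<partial>M) = V x"
          using V(1) x unfolding killed_harmonic_def I_def by auto
        have intD: "integrable M (\<lambda>\<omega>. I (X \<omega>) * \<bar>D (x + X \<omega>)\<bar>)"
          and leD: "\<bar>D x\<bar> \<le> (\<integral>\<omega>. I (X \<omega>) * \<bar>D (x + X \<omega>)\<bar> \<partial>M)"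
          using harmonic_abs_le[OF D x] unfolding I_def by auto
        have int\<phi>: "integrable M (\<lambda>\<omega>. \<phi> (X \<omega>))"
          unfolding \<phi>_def using intV intD by auto
        have "p * (c * (\<eta> * V x)) \<le> p * (c * V (x + s))"
          using Vy c p_pos by (intro mult_left_mono) auto
        also have "c * V (x + s) \<le> \<phi> s"
        proof -
          have "0 \<le> e * V (x + s)" using e Vy0 by simp
          then show ?thesis
            using Dy C(1) s(3) unfolding \<phi>_def I_def by (simp add: algebra_simps)
        qed
        then have "p * (c * V (x + s)) \<le> prob {\<omega> \<in> space M. X \<omega> = s} * \<phi> s"
          using s(1) p_pos c Vy0 by (intro mult_mono) auto
        also have "\<dots> \<le> (\<integral>\<omega>. \<phi> (X \<omega>) \<partial>M)"
          by (rule atom_le_integral[OF int\<phi> \<phi>0])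
        also have "\<dots> = (b + e) * V x + C - (\<integral>\<omega>. I (X \<omega>) * \<bar>D (x + X \<omega>)\<bar> \<partial>M)"
          unfolding \<phi>_def using intV intD eqV by (simp add: prob_space)
        also have "\<dots> \<le> (b + e) * V x + C - \<bar>D x\<bar>" using leD by simp
        finally have "3 * e * V x \<le> (b + e) * V x + C - \<bar>D x\<bar>"
          unfolding e_def by (simp add: mult_ac)
        moreover have "C \<le> e * V x" using elim(3) e by (simp add: pos_divide_le_eq mult.commute)
        ultimately show "\<bar>D x\<bar> \<le> (b - e) * V x" by (simp add: algebra_simps)
      qed
    qed
    then show "\<exists>c'>0. \<forall>\<^sub>F x in far. d x < A \<longrightarrow> (\<forall>y\<in>K \<inter> R. norm (y - x) \<le> L \<longrightarrow> d x + t \<le> d y \<longrightarrow>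
            y \<in> K \<inter> R \<longrightarrow> \<bar>D y\<bar> \<le> (b - c) * V y) \<longrightarrow> x \<in> K \<inter> R \<longrightarrow> \<bar>D x\<bar> \<le> (b - c') * V x"
      using e by blast
  qed
  then show ?thesis unfolding eventually_far by auto
qed

text \<open>
  The infimum of all asymptotic bounds for \<open>\<bar>D\<bar> / V\<close> is itself an upper bound for the limit superior of the
  ratio, so the preceding lemma forces it to be 0. An iteration in place of the infimum would not
  do: the improvement depends on \<open>b\<close> through the level at which the ratio is below \<open>b / 2\<close>.
\<close>

lemma harmonic_negligible_far:
  assumes V: "killed_harmonic M X K R V" "\<And>x. x \<in> K \<inter> R \<Longrightarrow> 0 \<le> V x"
    and D: "killed_harmonic M X K R D"
    and harnack: "0 < \<eta>" "eventually (\<lambda>x. \<forall>y\<in>K \<inter> R. norm (y - x) \<le> L \<longrightarrow> d x + t \<le> d y \<longrightarrow> \<eta> * V x \<le> V y) far"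
    and large: "\<And>B. eventually (\<lambda>x. B \<le> V x) far"
    and deep: "\<And>e. 0 < e \<Longrightarrow> \<exists>A. eventually (\<lambda>x. A \<le> d x \<longrightarrow> \<bar>D x\<bar> \<le> e * V x) far"
    and bounded: "eventually (\<lambda>x. \<bar>D x\<bar> \<le> C * V x) far"
    and e: "0 < e"
  shows "eventually (\<lambda>x. \<bar>D x\<bar> \<le> e * V x) far"
proof -
  define S where "S = {b. 0 \<le> b \<and> eventually (\<lambda>x. \<bar>D x\<bar> \<le> b * V x) far}"
  have weaken: "eventually (\<lambda>x. \<bar>D x\<bar> \<le> b' * V x) far"
    if "eventually (\<lambda>x. \<bar>D x\<bar> \<le> b * V x) far" "b \<le> b'" for b b'
    using that(1) eventually_far_state[of 0]
  proof eventually_elim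
    case (elim x)
    then show ?case using V(2)[of x] mult_right_mono[OF that(2), of "V x"] by auto
  qed
  have "max 0 C \<in> S" unfolding S_def using weaken[OF bounded, of "max 0 C"] by simp
  then have ne: "S \<noteq> {}" by blast
  have bdd: "bdd_below S" unfolding S_def by (auto intro: bdd_belowI[of _ 0])
  define b where "b = Inf S"
  have b0: "0 \<le> b" unfolding b_def using ne by (intro cInf_greatest) (auto simp: S_def)
  have above: "eventually (\<lambda>x. \<bar>D x\<bar> \<le> (b + e) * V x) far" if "0 < e" for e
  proof -
    have "Inf S < b + e" using that unfolding b_def by simp
    then obtain b' where "b' \<in> S" "b' < b + e"
      using cInf_lessD[OF ne] by blast
    then show ?thesis using weaken[of b' "b + e"] unfolding S_def by auto
  qed
  have "b = 0"
  proof (rule ccontr)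
    assume "b \<noteq> 0"
    then have "0 < b" using b0 by simp
    then obtain c where c: "0 < c" "eventually (\<lambda>x. \<bar>D x\<bar> \<le> (b - c) * V x) far"
      using harmonic_ratio_improvement[OF V D harnack large deep _ above] by blast
    define c' where "c' = min c b"
    have "b - c' \<in> S"
      unfolding S_def using weaken[OF c(2), of "b - c'"] by (auto simp: c'_def)
    then have "b \<le> b - c'" unfolding b_def using bdd by (intro cInf_lower) auto
    then show False using c(1) \<open>0 < b\<close> by (auto simp: c'_def min_def split: if_splits)
  qed
  then show ?thesis using above[OF e] by simp
qed

text \<open>
  A maximum principle. If \<open>\<bar>D\<bar> - e * V\<close> were positive somewhere, it would be so at finitely many points
  only, hence would attain a positive maximum. Being subharmonic, it would attain it again after
  each step of positive probability; repeating one step \<open>s \<noteq> 0\<close> leaves every finite set. The function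
  vanishes on leaving \<open>K \<inter> R\<close>, which is below the maximum, so the walk cannot escape that way.
\<close>

lemma harmonic_eq_zero:
  assumes V: "killed_harmonic M X K R V" "\<And>x. x \<in> K \<inter> R \<Longrightarrow> 0 \<le> V x"
    and D: "killed_harmonic M X K R D"
    and negligible: "\<And>e. 0 < e \<Longrightarrow> eventually (\<lambda>x. \<bar>D x\<bar> \<le> e * V x) far"
    and atom: "s \<noteq> 0" "0 < prob {\<omega> \<in> space M. X \<omega> = s}"
    and x: "x \<in> K \<inter> R"
  shows "D x = 0"
proof -
  have bound: "\<bar>D x\<bar> \<le> e * V x" if e: "0 < e" for e
  proof (rule ccontr)
    assume contr: "\<not> \<bar>D x\<bar> \<le> e * V x"
    define f where "f y = \<bar>D y\<bar> - e * V y" for y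
    obtain B where B: "\<forall>y\<in>K \<inter> R. B \<le> norm y \<longrightarrow> \<bar>D y\<bar> \<le> e * V y"
      using negligible[OF e] unfolding eventually_far by blast
    define P where "P = {y \<in> K \<inter> R. 0 < f y}"
    have finP: "finite P"
      by (rule finite_subset[OF _ finite_ball[of B]]) (use B in \<open>force simp: P_def f_def\<close>)
    have xP: "x \<in> P" unfolding P_def f_def using contr x by simp
    define a where "a = Max (f ` P)"
    have fa: "f y \<le> a" if "y \<in> P" for y unfolding a_def using finP that by simp
    have a0: "0 < a" using fa[OF xP] xP unfolding P_def by simp
    define Q where "Q = {y \<in> P. f y = a}"
    have finQ: "finite Q" unfolding Q_def using finP by simp
    have "a \<in> f ` P" unfolding a_def using finP xP by (intro Max_in) auto
    then have "Q \<noteq> {}" unfolding Q_def by auto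
    \<comment> \<open>The last of the maximum points in direction \<open>s\<close>; the step \<open>s\<close> leads to a later one.\<close>
    then obtain y where y: "y \<in> Q" "\<And>z. z \<in> Q \<Longrightarrow> z \<bullet> s \<le> y \<bullet> s"
      using finQ Max_in[of "(\<lambda>z. z \<bullet> s) ` Q"] Max_ge[of "(\<lambda>z. z \<bullet> s) ` Q"] by fastforce
    have yE: "y \<in> K \<inter> R" and fy: "f y = a" using y(1) unfolding Q_def P_def by auto
    define I where "I z = indicat_real (K \<inter> R) (y + z)" for z
    define g where "g z = I z * \<bar>D (y + z)\<bar> - e * (I z * V (y + z))" for z
    have g: "g z = I z * f (y + z)" for z
      unfolding g_def f_def by (simp add: algebra_simps)
    have ga: "g z \<le> a" for z
    proof (cases "y + z \<in> P")
      case True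
      then show ?thesis using fa[OF True] unfolding g I_def P_def by simp
    next
      case False
      then have "I z * f (y + z) \<le> 0" unfolding P_def I_def by (auto simp: indicator_def)
      then show ?thesis unfolding g using a0 by simp
    qed
    have intV: "integrable M (\<lambda>\<omega>. I (X \<omega>) * V (y + X \<omega>))"
      and eqV: "(\<integral>\<omega>. I (X \<omega>) * V (y + X \<omega>) \<partial>M) = V y"
      using V(1) yE unfolding killed_harmonic_def I_def by auto
    have intD: "integrable M (\<lambda>\<omega>. I (X \<omega>) * \<bar>D (y + X \<omega>)\<bar>)"
      and leD: "\<bar>D y\<bar> \<le> (\<integral>\<omega>. I (X \<omega>) * \<bar>D (y + X \<omega>)\<bar> \<partial>M)"
      using harmonic_abs_le[OF D yE] unfolding I_def by auto
    have intg: "integrable M (\<lambda>\<omega>. g (X \<omega>))"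
      unfolding g_def using intV intD by auto
    have "a \<le> (\<integral>\<omega>. g (X \<omega>) \<partial>M)"
      unfolding g_def using intV intD eqV leD fy unfolding f_def by simp
    moreover have "prob {\<omega> \<in> space M. X \<omega> = s} * (a - g s) \<le> (\<integral>\<omega>. a - g (X \<omega>) \<partial>M)"
      using intg ga by (intro atom_le_integral[of "\<lambda>z. a - g z"]) auto
    ultimately have "prob {\<omega> \<in> space M. X \<omega> = s} * (a - g s) \<le> 0"
      using intg by (simp add: prob_space)
    then have "a \<le> g s" using atom(2) by (simp add: mult_le_0_iff)
    then have gs: "g s = a" using ga[of s] by simp
    then have "y + s \<in> K \<inter> R" "f (y + s) = a"
      using a0 unfolding g I_def indicator_def by (auto simp del: Int_iff split: if_splits simp: of_bool_def)
    then have "y + s \<in> Q" unfolding Q_def P_def using a0 by simp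
    then have "(y + s) \<bullet> s \<le> y \<bullet> s" by (rule y(2))
    then have "s \<bullet> s \<le> 0" by (simp add: inner_add_left)
    then show False using atom(1) inner_gt_zero_iff[of s] by linarith
  qed
  have "\<bar>D x\<bar> \<le> 0"
  proof (rule field_le_epsilon)
    fix e :: real assume e: "0 < e"
    have V0: "0 \<le> V x" using V(2) x by blast
    have "\<bar>D x\<bar> \<le> e / (1 + V x) * V x" using e V0 by (intro bound) auto
    also have "\<dots> \<le> e" using e V0 by (simp add: field_simps)
    finally show "\<bar>D x\<bar> \<le> 0 + e" by simp
  qed
  then show ?thesis by simp
qed

text \<open>
  The two growth bounds together are a Harnack inequality, \<open>\<eta> * V x \<le> V y\<close> for a deeper neighbour \<open>y\<close> of
  \<open>x\<close>; the lower one makes \<open>V\<close> tend to infinity, and allows measuring \<open>D\<close> in terms of \<open>V\<close>.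
\<close>

lemma harmonic_eq_zero_of_growth:
  assumes V: "killed_harmonic M X K R V" "\<And>x. x \<in> K \<inter> R \<Longrightarrow> 0 \<le> V x"
    and D: "killed_harmonic M X K R D"
    and n: "0 < n"
    and V_deep: "0 < a" "eventually (\<lambda>x. A \<le> d x \<longrightarrow> a * growth n x \<le> V x) far"
                "0 < b" "eventually (\<lambda>x. A \<le> d x \<longrightarrow> b * V x \<le> growth n x) far"
    and D_deep: "\<And>e. 0 < e \<Longrightarrow> \<exists>A. eventually (\<lambda>x. A \<le> d x \<longrightarrow> \<bar>D x\<bar> \<le> e * V x) far"
    and D_growth: "eventually (\<lambda>x. \<bar>D x\<bar> \<le> C * growth n x + V x) far"
    and atom: "s \<noteq> 0" "0 < prob {\<omega> \<in> space M. X \<omega> = s}"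
    and x: "x \<in> K \<inter> R"
  shows "D x = 0"
proof -
  obtain c where c: "0 < c" "eventually (\<lambda>x. c * growth n x \<le> V x) far"
    using harmonic_lower_growth[OF V, of A n] V_deep by blast
  obtain c' where c': "0 < c'" "eventually (\<lambda>x. c' * V x \<le> growth n x) far"
    using harmonic_upper_growth[OF V, of A n] V_deep by blast
  define \<eta> where "\<eta> = c * c' / 2 ^ n"
  have \<eta>: "0 < \<eta>" unfolding \<eta>_def using c c' by simp
  have harnack: "eventually (\<lambda>x. \<forall>y\<in>K \<inter> R. norm (y - x) \<le> L \<longrightarrow> d x + t \<le> d y \<longrightarrow> \<eta> * V x \<le> V y) far"
    using c'(2) eventually_far_nearby[OF c(2)] eventually_far_state[of "2 * L"]
  proof eventually_elim
    case (elim x)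
    show ?case
    proof (intro ballI impI)
      fix y assume y: "y \<in> K \<inter> R" "norm (y - x) \<le> L" "d x + t \<le> d y"
      have "\<eta> * V x = c / 2 ^ n * (c' * V x)" unfolding \<eta>_def by simp
      also have "\<dots> \<le> c / 2 ^ n * growth n x"
        using elim(1) c(1) by (intro mult_left_mono) auto
      also have "\<dots> \<le> c / 2 ^ n * (2 ^ n * growth n y)"
        using y elim(3) t_pos c(1) by (intro mult_left_mono growth_inward(1)) auto
      also have "\<dots> = c * growth n y" by simp
      also have "\<dots> \<le> V y" using elim(2) y by blast
      finally show "\<eta> * V x \<le> V y" .
    qed
  qed
  have large: "eventually (\<lambda>x. B \<le> V x) far" for B
    using c(2) eventually_far_state[of "max 1 (B / c)"]
  proof eventually_elim
    case (elim x)
    have "B \<le> c * norm x" using elim(2) c(1) by (simp add: pos_divide_le_eq mult.commute)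
    also have "norm x \<le> norm x ^ n" using elim(2) n by (intro self_le_power) auto
    then have "c * norm x \<le> c * norm x ^ n" using c(1) by simp
    also have "norm x ^ n \<le> growth n x"
      unfolding growth_def using d_nonneg[of x] elim(2) by (simp add: distrib_right)
    then have "c * norm x ^ n \<le> c * growth n x" using c(1) by simp
    also have "\<dots> \<le> V x" by (rule elim(1))
    finally show ?case .
  qed
  have "eventually (\<lambda>x. \<bar>D x\<bar> \<le> (\<bar>C\<bar> / c + 1) * V x) far"
    using c(2) D_growth eventually_far_state[of 0]
  proof eventually_elim
    case (elim x)
    have "C * growth n x \<le> \<bar>C\<bar> * growth n x"
      using growth_nonneg[of x n] elim(3) by (simp add: mult_right_mono)
    also have "\<dots> = \<bar>C\<bar> / c * (c * growth n x)" using c(1) by simp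
    also have "\<dots> \<le> \<bar>C\<bar> / c * V x" using elim(1) c(1) by (intro mult_left_mono) auto
    finally show ?case using elim(2) by (simp add: algebra_simps)
  qed
  then show ?thesis
    using harmonic_eq_zero[OF V D _ atom x] harmonic_negligible_far[OF V D \<eta> harnack large D_deep] by blast
qed
end

section \<open>Geometry of the wedge and of the lattice\<close>

text \<open>
  For \<open>0 < \<alpha> \<le> pi / 2\<close> the minimum of the signed distances to the two lines that carry the sides of the wedge
  is, inside it, the distance to its boundary. Unlike that distance it is explicit and
  non-positive outside, which makes the wedge an intersection of two half-planes.
\<close>

definition wall_dist :: "real \<Rightarrow> real^2 \<Rightarrow> real" where
  "wall_dist \<alpha> x = min (x $ 2) (sin \<alpha> * x $ 1 - cos \<alpha> * x $ 2)"

lemma norm_vec2: "norm (x :: real^2) ^ 2 = (x $ 1)^2 + (x $ 2)^2"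
  by (simp add: norm_vec_def L2_set_def UNIV_2)

lemma abs_linear_le_norm:
  fixes x :: "real^2"
  assumes "a^2 + b^2 = 1"
  shows "\<bar>a * x $ 1 + b * x $ 2\<bar> \<le> norm x"
proof -
  have "(a * x $ 1 + b * x $ 2)^2 + (a * x $ 2 - b * x $ 1)^2 = (a^2 + b^2) * ((x $ 1)^2 + (x $ 2)^2)"
    by (simp add: power2_eq_square algebra_simps)
  then have "(a * x $ 1 + b * x $ 2)^2 \<le> (norm x)^2"
    using assms by (simp add: norm_vec2) (metis zero_le_power2 add_le_same_cancel1 le_add_same_cancel1)
  then show ?thesis by (simp add: abs_le_square_iff[symmetric])
qed

lemma abs_side_le_norm: "\<bar>sin \<alpha> * x $ 1 - cos \<alpha> * x $ 2\<bar> \<le> norm (x :: real^2)"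
  using abs_linear_le_norm[of "sin \<alpha>" "- cos \<alpha>" x] by simp

lemma abs_snd_le_norm: "\<bar>x $ 2\<bar> \<le> norm (x :: real^2)"
  using abs_linear_le_norm[of 0 1 x] by simp

lemma wall_dist_lipschitz: "wall_dist \<alpha> y \<le> wall_dist \<alpha> x + norm (y - x)"
  using abs_side_le_norm[of \<alpha> "y - x"] abs_snd_le_norm[of "y - x"]
  unfolding wall_dist_def by (simp add: algebra_simps min_def abs_le_iff)

lemma vec2_eq_polar: "\<exists>r \<phi>. 0 \<le> r \<and> -pi < \<phi> \<and> \<phi> \<le> pi \<and> (x :: real^2) = vector [r * cos \<phi>, r * sin \<phi>]"
proof -
  let ?z = "Complex (x $ 1) (x $ 2)"
  have "?z = rcis (cmod ?z) (Arg ?z)" by (simp add: rcis_cmod_Arg)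
  then have "x $ 1 = cmod ?z * cos (Arg ?z)" "x $ 2 = cmod ?z * sin (Arg ?z)"
    by (metis complex.sel Re_rcis, metis complex.sel Im_rcis)
  then have "x = vector [cmod ?z * cos (Arg ?z), cmod ?z * sin (Arg ?z)]"
    by (simp add: vec_eq_iff forall_2)
  then show ?thesis using Arg_bounded[of ?z] norm_ge_zero by blast
qed

lemma wedge_eq_half_planes:
  assumes "0 < \<alpha>" "\<alpha> < pi"
  shows "wedge \<alpha> = {x. 0 < wall_dist \<alpha> x}"
proof (intro set_eqI iffI)
  fix x assume "x \<in> wedge \<alpha>"
  then obtain r \<phi> where x: "x = vector [r * cos \<phi>, r * sin \<phi>]" "0 < r" "0 < \<phi>" "\<phi> < \<alpha>"
    unfolding wedge_def by auto
  have "0 < sin \<phi>" "0 < sin (\<alpha> - \<phi>)" using x assms by (auto intro!: sin_gt_zero)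
  then have "0 < r * sin \<phi>" "0 < r * sin (\<alpha> - \<phi>)" using x by auto
  then show "x \<in> {x. 0 < wall_dist \<alpha> x}"
    unfolding wall_dist_def x(1) by (simp add: sin_diff algebra_simps)
next
  fix x assume "x \<in> {x. 0 < wall_dist \<alpha> x}"
  moreover obtain r \<phi> where x: "x = vector [r * cos \<phi>, r * sin \<phi>]" "0 \<le> r" "-pi < \<phi>" "\<phi> \<le> pi"
    using vec2_eq_polar by metis
  ultimately have pos: "0 < r * sin \<phi>" "0 < r * sin (\<alpha> - \<phi>)"
    unfolding wall_dist_def by (simp_all add: sin_diff algebra_simps)
  then have r: "0 < r" and sin: "0 < sin \<phi>" "0 < sin (\<alpha> - \<phi>)" using x(2) by (auto simp: zero_less_mult_iff)
  have "0 < \<phi>"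
    using sin(1) sin_ge_zero[of "- \<phi>"] x(3) by (simp add: not_le[symmetric]) (metis linorder_not_less neg_0_le_iff_le less_imp_le minus_less_iff)
  moreover have "\<phi> < \<alpha>"
  proof (rule ccontr)
    assume "\<not> \<phi> < \<alpha>"
    then have "0 \<le> sin (\<phi> - \<alpha>)" using x(4) assms by (intro sin_ge_zero) auto
    then show False using sin(2) sin_minus[of "\<phi> - \<alpha>"] by simp
  qed
  ultimately show "x \<in> wedge \<alpha>" unfolding wedge_def using x(1) r by blast
qed

lemma continuous_wall_dist: "continuous_on UNIV (wall_dist \<alpha>)"
  unfolding wall_dist_def by (intro continuous_intros)

lemma open_wedge: "0 < \<alpha> \<Longrightarrow> \<alpha> < pi \<Longrightarrow> open (wedge \<alpha>)"
  unfolding wedge_eq_half_planes by (intro open_Collect_less continuous_wall_dist continuous_on_const)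

lemma wall_dist_le_infdist_frontier:
  assumes "0 < \<alpha>" "\<alpha> < pi" "x \<in> wedge \<alpha>"
  shows "wall_dist \<alpha> x \<le> infdist x (frontier (wedge \<alpha>))"
proof -
  have "0 \<notin> wedge \<alpha>" unfolding wedge_eq_half_planes[OF assms(1,2)] wall_dist_def by simp
  then have ne: "frontier (wedge \<alpha>) \<noteq> {}" using assms(3) by (auto simp: frontier_eq_empty)
  have "wall_dist \<alpha> x \<le> dist x y" if "y \<in> frontier (wedge \<alpha>)" for y
  proof -
    have "y \<notin> wedge \<alpha>" using that open_wedge[OF assms(1,2)] by (simp add: frontier_def interior_open)
    then have "wall_dist \<alpha> y \<le> 0" unfolding wedge_eq_half_planes[OF assms(1,2)] by simp
    then show ?thesis using wall_dist_lipschitz[of \<alpha> x y] by (simp add: dist_norm)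
  qed
  then show ?thesis unfolding infdist_notempty[OF ne] using ne by (intro cINF_greatest) auto
qed

text \<open>
  Far from the origin a point of the wedge cannot be close to both sides. In Cartesian terms, both
  coordinates are combinations of the two signed distances.
\<close>

lemma norm_le_side_sum:
  assumes "0 < \<alpha>" "\<alpha> \<le> pi / 2" "x \<in> wedge \<alpha>"
  shows "sin \<alpha> * norm x \<le> 2 * (x $ 2 + (sin \<alpha> * x $ 1 - cos \<alpha> * x $ 2))"
proof -
  have s: "0 < sin \<alpha>" "0 \<le> cos \<alpha>" using assms by (auto intro!: sin_gt_zero cos_ge_zero)
  have "0 < wall_dist \<alpha> x" using assms wedge_eq_half_planes[of \<alpha>] by auto
  then have x: "0 < x $ 2" "0 < sin \<alpha> * x $ 1 - cos \<alpha> * x $ 2" unfolding wall_dist_def by auto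
  have "0 \<le> cos \<alpha> * x $ 2" using s x by simp
  then have "0 < sin \<alpha> * x $ 1" using x by linarith
  then have x1: "0 < x $ 1" using s by (simp add: zero_less_mult_iff)
  have "norm x \<le> x $ 1 + x $ 2" using norm_le_l1_cart[of x] x x1 by (simp add: UNIV_2)
  then have "sin \<alpha> * norm x \<le> sin \<alpha> * x $ 1 + sin \<alpha> * x $ 2"
    using s by (metis distrib_left mult_left_mono less_imp_le)
  moreover have "sin \<alpha> * x $ 2 \<le> x $ 2" "cos \<alpha> * x $ 2 \<le> x $ 2" using x by (simp_all add: mult_left_le_one_le mult_le_cancel_right1)
  ultimately show ?thesis using x by argo
qed

lemma abs_sin_mult_le: "\<bar>sin (real n * \<phi>)\<bar> \<le> real n * \<bar>sin \<phi>\<bar>"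
proof (induction n)
  case (Suc n)
  have "\<bar>sin (real (Suc n) * \<phi>)\<bar> = \<bar>sin (real n * \<phi>) * cos \<phi> + cos (real n * \<phi>) * sin \<phi>\<bar>"
    by (simp add: distrib_right sin_add algebra_simps)
  also have "\<dots> \<le> \<bar>sin (real n * \<phi>)\<bar> * \<bar>cos \<phi>\<bar> + \<bar>cos (real n * \<phi>)\<bar> * \<bar>sin \<phi>\<bar>"
    by (metis abs_mult abs_triangle_ineq)
  also have "\<dots> \<le> \<bar>sin (real n * \<phi>)\<bar> * 1 + 1 * \<bar>sin \<phi>\<bar>"
    by (intro add_mono mult_left_mono mult_right_mono) auto
  finally show ?case using Suc by (simp add: algebra_simps)
qed simp

text \<open>
  Sine of the multiple and minimum are invariant under \<open>\<phi> \<mapsto> pi / m - \<phi>\<close>. The lower bound is the monotonicity of the sine below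
  \<open>pi / 2\<close>, applied to the smaller of \<open>\<phi>\<close> and \<open>pi / m - \<phi>\<close>; the upper one is \<open>\<bar>sin (m * \<phi>)\<bar> \<le> m * \<bar>sin \<phi>\<bar>\<close>.
\<close>

lemma sin_mult_bounds:
  assumes m: "0 < m" and \<phi>: "0 < \<phi>" "\<phi> < pi / real m"
  shows "min (sin \<phi>) (sin (pi / real m - \<phi>)) \<le> sin (real m * \<phi>)"
    and "sin (real m * \<phi>) \<le> real m * min (sin \<phi>) (sin (pi / real m - \<phi>))"
proof -
  define \<psi> where "\<psi> = pi / real m - \<phi>"
  have \<psi>: "0 < \<psi>" "\<psi> < pi / real m" using \<phi> unfolding \<psi>_def by auto
  have eq: "real m * \<psi> = pi - real m * \<phi>" unfolding \<psi>_def using m by (simp add: algebra_simps)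
  then have refl: "sin (real m * \<psi>) = sin (real m * \<phi>)" by simp
  have lower: "sin \<theta> \<le> sin (real m * \<theta>)" if "0 < \<theta>" "real m * \<theta> \<le> pi / 2" for \<theta>
  proof (rule sin_monotone_2pi_le)
    show "\<theta> \<le> real m * \<theta>" using that(1) m by simp
  qed (use that pi_gt_zero in \<open>linarith | simp\<close>)+
  have "real m * \<phi> \<le> pi / 2 \<or> real m * \<psi> \<le> pi / 2" using eq by linarith
  then show "min (sin \<phi>) (sin (pi / real m - \<phi>)) \<le> sin (real m * \<phi>)"
    using lower[of \<phi>] lower[of \<psi>] \<phi>(1) \<psi>(1) refl unfolding \<psi>_def[symmetric] by auto
  have "pi / real m \<le> pi" using m by (simp add: field_simps)
  then have "0 \<le> sin \<phi>" "0 \<le> sin \<psi>" using \<phi> \<psi> by (auto intro!: sin_ge_zero)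
  then have "sin (real m * \<phi>) \<le> real m * sin \<phi>" "sin (real m * \<phi>) \<le> real m * sin \<psi>"
    using abs_sin_mult_le[of m \<phi>] abs_sin_mult_le[of m \<psi>] refl by auto
  then show "sin (real m * \<phi>) \<le> real m * min (sin \<phi>) (sin (pi / real m - \<phi>))"
    unfolding \<psi>_def[symmetric] by (simp add: min_def)
qed

text \<open>
  In polar coordinates \<open>u = r ^ m * sin (m * \<phi>)\<close>, while the depth is \<open>r\<close> times the smaller of \<open>sin \<phi>\<close> and
  \<open>sin (pi / m - \<phi>)\<close>. So \<open>u\<close> grows linearly in the depth, and dominates any polynomial of lower degree
  at large depth.
\<close>

lemma wedge_harmonic_bounds:
  assumes m: "0 < m" and x: "x \<in> wedge (pi / real m)"
  shows "wall_dist (pi / real m) x * norm x ^ (m - 1) \<le> wedge_harmonic m x"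
    and "wedge_harmonic m x \<le> real m * (wall_dist (pi / real m) x * norm x ^ (m - 1))"
proof -
  obtain r \<phi> where r: "x = vector [r * cos \<phi>, r * sin \<phi>]" "0 < r" "0 < \<phi>" "\<phi> < pi / real m"
    using x unfolding wedge_def by auto
  let ?s = "min (sin \<phi>) (sin (pi / real m - \<phi>))"
  have "norm x ^ 2 = r ^ 2 * (cos \<phi> ^ 2 + sin \<phi> ^ 2)"
    unfolding norm_vec2 r(1) by (simp add: power_mult_distrib distrib_left del: sin_cos_squared_add2)
  then have nx: "norm x = r" using r(2) by (simp add: power2_eq_iff_nonneg)
  have d: "wall_dist (pi / real m) x = r * ?s"
    unfolding wall_dist_def r(1) sin_diff using r(2) by (simp add: min_mult_distrib_left algebra_simps)
  have "Complex (x $ 1) (x $ 2) = rcis r \<phi>" unfolding r(1) by (simp add: complex_eq_iff)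
  then have u: "wedge_harmonic m x = r ^ m * sin (real m * \<phi>)"
    unfolding wedge_harmonic_def by (simp add: DeMoivre2)
  have rm: "r ^ m = r * r ^ (m - 1)" using m by (cases m) auto
  have "r ^ m * ?s \<le> r ^ m * sin (real m * \<phi>)" "r ^ m * sin (real m * \<phi>) \<le> r ^ m * (real m * ?s)"
    using sin_mult_bounds[OF m r(3,4)] r(2) by (intro mult_left_mono; simp)+
  then show "wall_dist (pi / real m) x * norm x ^ (m - 1) \<le> wedge_harmonic m x"
    "wedge_harmonic m x \<le> real m * (wall_dist (pi / real m) x * norm x ^ (m - 1))"
    unfolding d nx u rm by (simp_all only: mult_ac)
qed

text \<open>
  The coordinate map of a basis is injective and linear, hence bounded below, so lattice points in a
  ball have bounded integer coordinates.
\<close>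

lemma lattice2_finite_ball:
  assumes "lattice2 R"
  shows "finite {x \<in> R. norm x < B}"
proof -
  obtain v w where vw: "v \<noteq> w" "independent {v, w}" "R = {of_int a *\<^sub>R v + of_int b *\<^sub>R w | a b. True}"
    using assms unfolding lattice2_def by blast
  define T where "T q = fst q *\<^sub>R v + snd q *\<^sub>R w" for q :: "real \<times> real"
  have lin: "linear T" unfolding T_def by (intro linearI) (auto simp: algebra_simps)
  have "q = 0" if "T q = 0" for q
  proof -
    have "fst q = 0 \<and> snd q = 0"
      using independentD[OF vw(2), of "{v, w}" "\<lambda>z. if z = v then fst q else snd q" v]
        independentD[OF vw(2), of "{v, w}" "\<lambda>z. if z = v then fst q else snd q" w] that vw(1)
      unfolding T_def by auto
    then show ?thesis by (simp add: prod_eq_iff)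
  qed
  then have "inj T" using lin by (simp add: linear_injective_0)
  then obtain c where c: "0 < c" "\<And>q. c * norm q \<le> norm (T q)"
    using linear_inj_bounded_below_pos[OF lin] by blast
  define N where "N = \<lceil>B / c\<rceil>"
  have "{x \<in> R. norm x < B} \<subseteq> (\<lambda>(a, b). of_int a *\<^sub>R v + of_int b *\<^sub>R w) ` ({-N..N} \<times> {-N..N})"
  proof
    fix x assume x: "x \<in> {x \<in> R. norm x < B}"
    then obtain a b where ab: "x = of_int a *\<^sub>R v + of_int b *\<^sub>R w" unfolding vw(3) by auto
    define q where "q = (real_of_int a, real_of_int b)"
    have "c * norm q < B" using c(2)[of q] x unfolding ab T_def q_def by auto
    then have "norm q < B / c" using c(1) by (simp add: pos_less_divide_eq mult.commute)
    then have "norm q \<le> of_int N" unfolding N_def by linarith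
    moreover have "\<bar>real_of_int a\<bar> \<le> norm q" "\<bar>real_of_int b\<bar> \<le> norm q"
      using norm_fst_le[of "real_of_int a" "real_of_int b"]
        norm_snd_le[of "real_of_int b" "real_of_int a"] unfolding q_def by auto
    ultimately have "\<bar>real_of_int a\<bar> \<le> of_int N" "\<bar>real_of_int b\<bar> \<le> of_int N" by linarith+
    then have "a \<in> {-N..N}" "b \<in> {-N..N}" by auto
    then show "x \<in> (\<lambda>(a, b). of_int a *\<^sub>R v + of_int b *\<^sub>R w) ` ({-N..N} \<times> {-N..N})"
      unfolding ab by (intro image_eqI[of _ _ "(a, b)"]) auto
  qed
  then show ?thesis by (rule finite_subset) simp
qed

lemma lattice2_add_diff:
  assumes "lattice2 R" "x \<in> R" "y \<in> R"
  shows "x + y \<in> R" "x - y \<in> R"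
proof -
  obtain v w where R: "R = {of_int a *\<^sub>R v + of_int b *\<^sub>R w | a b. True}"
    using assms(1) unfolding lattice2_def by blast
  obtain a b a' b' where "x = of_int a *\<^sub>R v + of_int b *\<^sub>R w" "y = of_int a' *\<^sub>R v + of_int b' *\<^sub>R w"
    using assms(2,3) unfolding R by auto
  then have "x + y = of_int (a + a') *\<^sub>R v + of_int (b + b') *\<^sub>R w"
    "x - y = of_int (a - a') *\<^sub>R v + of_int (b - b') *\<^sub>R w" by (auto simp: algebra_simps)
  then show "x + y \<in> R" "x - y \<in> R" unfolding R by blast+
qed

lemma countable_lattice2:
  assumes "lattice2 R" shows "countable R"
proof -
  have "R = (\<Union>k. {x \<in> R. norm x < real k})" using reals_Archimedean2 by auto
  moreover have "countable (\<Union>k. {x \<in> R. norm x < real k})"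
    using countable_finite[OF lattice2_finite_ball[OF assms]] by (intro countable_UN) auto
  ultimately show ?thesis by simp
qed

lemma poly2_bound:
  assumes "poly2_deg_le n q"
  obtains C where "0 \<le> C" "\<And>x. \<bar>q x\<bar> \<le> C * (1 + norm x) ^ n"
proof -
  obtain c where c: "\<And>x. q x = (\<Sum>i\<le>n. \<Sum>j\<le>n - i. c i j * (x $ 1) ^ i * (x $ 2) ^ j)"
    using assms unfolding poly2_deg_le_def by blast
  define C where "C = (\<Sum>i\<le>n. \<Sum>j\<le>n - i. \<bar>c i j\<bar>)"
  have "\<bar>q x\<bar> \<le> C * (1 + norm x) ^ n" for x
  proof -
    have mon: "\<bar>c i j * (x $ 1) ^ i * (x $ 2) ^ j\<bar> \<le> \<bar>c i j\<bar> * (1 + norm x) ^ n" if "i + j \<le> n" for i j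
    proof -
      have "\<bar>x $ 1\<bar> \<le> 1 + norm x" "\<bar>x $ 2\<bar> \<le> 1 + norm x"
        using component_le_norm_cart[of x 1] component_le_norm_cart[of x 2] by auto
      then have "\<bar>x $ 1\<bar> ^ i * \<bar>x $ 2\<bar> ^ j \<le> (1 + norm x) ^ i * (1 + norm x) ^ j"
        by (intro mult_mono power_mono) auto
      also have "\<dots> \<le> (1 + norm x) ^ n"
        unfolding power_add[symmetric] using that by (intro power_increasing) auto
      finally show ?thesis by (simp add: abs_mult power_abs mult.assoc mult_left_mono)
    qed
    have "\<bar>q x\<bar> \<le> (\<Sum>i\<le>n. \<Sum>j\<le>n - i. \<bar>c i j * (x $ 1) ^ i * (x $ 2) ^ j\<bar>)"
      unfolding c by (intro order_trans[OF sum_abs] sum_mono sum_abs)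
    also have "\<dots> \<le> (\<Sum>i\<le>n. \<Sum>j\<le>n - i. \<bar>c i j\<bar> * (1 + norm x) ^ n)"
      by (intro sum_mono mon) auto
    finally show ?thesis unfolding C_def by (simp add: sum_distrib_right)
  qed
  moreover have "0 \<le> C" unfolding C_def by (intro sum_nonneg) auto
  ultimately show ?thesis using that by blast
qed

lemma continuous_poly2:
  assumes "poly2_deg_le n q" shows "continuous_on UNIV q"
proof -
  obtain c where c: "q = (\<lambda>x. \<Sum>i\<le>n. \<Sum>j\<le>n - i. c i j * (x $ 1) ^ i * (x $ 2) ^ j)"
    using assms unfolding poly2_deg_le_def by blast
  show ?thesis unfolding c by (intro continuous_intros)
qed

lemma abs_wedge_harmonic_le: "\<bar>wedge_harmonic m x\<bar> \<le> norm x ^ m"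
proof -
  have "cmod (Complex (x $ 1) (x $ 2)) = norm x"
    by (simp add: cmod_def norm_vec_def L2_set_def UNIV_2)
  then show ?thesis
    unfolding wedge_harmonic_def using abs_Im_le_cmod[of "Complex (x $ 1) (x $ 2) ^ m"]
    by (simp add: norm_power)
qed

lemma continuous_wedge_harmonic: "continuous_on UNIV (wedge_harmonic m)"
  unfolding wedge_harmonic_def Complex_eq by (intro continuous_intros)

section \<open>One step of the walk\<close>

text \<open>
  Otherwise the component of \<open>X\<close> in direction \<open>(a, b)\<close> would be non-positive with mean 0, so zero almost
  surely; but its variance is \<open>a^2 + b^2\<close>.
\<close>

lemma (in prob_space) atom_in_half_plane:
  fixes X :: "'a \<Rightarrow> real^2"
  assumes X [measurable]: "X \<in> borel_measurable M"
    and mean: "\<And>i. (\<integral>\<omega>. X \<omega> $ i \<partial>M) = 0"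
    and cov: "\<And>i j. (\<integral>\<omega>. X \<omega> $ i * X \<omega> $ j \<partial>M) = (if i = j then 1 else 0)"
    and R: "countable R" "AE \<omega> in M. X \<omega> \<in> R"
    and ab: "a^2 + b^2 = (1::real)"
  shows "\<exists>s\<in>R. 0 < prob {\<omega> \<in> space M. X \<omega> = s} \<and> 0 < a * s $ 1 + b * s $ 2"
proof (rule ccontr)
  assume none: "\<not> ?thesis"
  define Y where "Y \<omega> = a * X \<omega> $ 1 + b * X \<omega> $ 2" for \<omega>
  have [measurable]: "(\<lambda>\<omega>. X \<omega> $ i) \<in> borel_measurable M" for i
    by (rule measurable_compose[OF X borel_measurable_continuous_onI]) (intro continuous_intros)
  have sq: "integrable M (\<lambda>\<omega>. X \<omega> $ i * X \<omega> $ i)" for i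
    using not_integrable_integral_eq cov[of i i] by force
  have int1: "integrable M (\<lambda>\<omega>. X \<omega> $ i)" for i
  proof (rule Bochner_Integration.integrable_bound)
    show "integrable M (\<lambda>\<omega>. 1 + X \<omega> $ i * X \<omega> $ i)" using sq by auto
    have "\<bar>z\<bar> \<le> 1 + z * z" for z :: real
      using zero_le_square[of "\<bar>z\<bar> - 1"] by (simp add: algebra_simps abs_if split: if_splits)
    then show "AE \<omega> in M. norm (X \<omega> $ i) \<le> norm (1 + X \<omega> $ i * X \<omega> $ i)" by simp
  qed measurable
  have int2: "integrable M (\<lambda>\<omega>. X \<omega> $ 1 * X \<omega> $ 2)"
  proof (rule Bochner_Integration.integrable_bound)
    show "integrable M (\<lambda>\<omega>. X \<omega> $ 1 * X \<omega> $ 1 + X \<omega> $ 2 * X \<omega> $ 2)" using sq by auto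
    have "\<bar>y * z\<bar> \<le> y * y + z * z" for y z :: real
    proof -
      have "2 * \<bar>y * z\<bar> \<le> y * y + z * z"
        using sum_squares_bound[of "\<bar>y\<bar>" "\<bar>z\<bar>"] by (simp add: abs_mult power2_eq_square)
      then show ?thesis using abs_ge_zero[of "y * z"] by linarith
    qed
    then show "AE \<omega> in M. norm (X \<omega> $ 1 * X \<omega> $ 2) \<le> norm (X \<omega> $ 1 * X \<omega> $ 1 + X \<omega> $ 2 * X \<omega> $ 2)"
      by simp
  qed measurable
  have intY: "integrable M Y" unfolding Y_def using int1 by auto
  have EY: "(\<integral>\<omega>. Y \<omega> \<partial>M) = 0" unfolding Y_def using int1 mean by simp
  have "Y \<omega> * Y \<omega> = a^2 * (X \<omega> $ 1 * X \<omega> $ 1) + 2 * a * b * (X \<omega> $ 1 * X \<omega> $ 2) + b^2 * (X \<omega> $ 2 * X \<omega> $ 2)" for \<omega>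
    unfolding Y_def by (simp add: power2_eq_square algebra_simps)
  then have EY2: "(\<integral>\<omega>. Y \<omega> * Y \<omega> \<partial>M) = 1"
    using sq int2 cov ab by simp
  have "AE \<omega> in M. \<forall>s\<in>{s \<in> R. 0 < a * s $ 1 + b * s $ 2}. X \<omega> \<noteq> s"
  proof (subst AE_ball_countable)
    show "countable {s \<in> R. 0 < a * s $ 1 + b * s $ 2}" using R(1) by simp
    show "\<forall>s\<in>{s \<in> R. 0 < a * s $ 1 + b * s $ 2}. AE \<omega> in M. X \<omega> \<noteq> s"
    proof
      fix s assume s: "s \<in> {s \<in> R. 0 < a * s $ 1 + b * s $ 2}"
      have "\<not> 0 < prob {\<omega> \<in> space M. X \<omega> = s}" using none s by blast
      then have "prob {\<omega> \<in> space M. X \<omega> = s} = 0" by (simp add: zero_less_measure_iff)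
      then show "AE \<omega> in M. X \<omega> \<noteq> s"
        by (subst AE_iff_measurable[OF _ refl]) (auto simp: emeasure_eq_measure)
    qed
  qed
  then have "AE \<omega> in M. 0 \<le> - Y \<omega>"
    using R(2) unfolding Y_def by eventually_elim force
  moreover have "integrable M (\<lambda>\<omega>. - Y \<omega>)" "(\<integral>\<omega>. - Y \<omega> \<partial>M) = 0" using intY EY by auto
  ultimately have "AE \<omega> in M. - Y \<omega> = 0"
    using integral_nonneg_eq_0_iff_AE by blast
  then have "AE \<omega> in M. Y \<omega> * Y \<omega> = 0" by eventually_elim simp
  then have "(\<integral>\<omega>. Y \<omega> * Y \<omega> \<partial>M) = 0" by (rule integral_eq_zero_AE)
  then show False using EY2 by simp
qed

text \<open>
  Four atoms suffice, one on either side of each of the two directions normal to the sides of the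
  wedge. A point closer to one side moves away from it along the corresponding atom, or along the
  negative of the opposite one; the other side is too far away to matter.
\<close>

lemma (in prob_space) inward_steps:
  fixes X :: "'a \<Rightarrow> real^2"
  assumes X [measurable]: "X \<in> borel_measurable M"
    and mean: "\<And>i. (\<integral>\<omega>. X \<omega> $ i \<partial>M) = 0"
    and cov: "\<And>i j. (\<integral>\<omega>. X \<omega> $ i * X \<omega> $ j \<partial>M) = (if i = j then 1 else 0)"
    and R: "lattice2 R" "AE \<omega> in M. X \<omega> \<in> R"
    and \<alpha>: "0 < \<alpha>" "\<alpha> \<le> pi / 2"
  obtains p t L where "layered_walk M X (wedge \<alpha>) R (wall_dist \<alpha>) p t L"
proof -
  have \<alpha>': "\<alpha> < pi" using \<alpha> pi_gt_zero by linarith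
  define side where "side z = sin \<alpha> * z $ 1 - cos \<alpha> * z $ 2" for z :: "real^2"
  have d: "wall_dist \<alpha> z = min (z $ 2) (side z)" for z unfolding wall_dist_def side_def ..
  note atom = atom_in_half_plane[OF X mean cov countable_lattice2[OF R(1)] R(2)]
  define P where "P s = prob {\<omega> \<in> space M. X \<omega> = s}" for s
  obtain s1 where s1: "s1 \<in> R" "0 < P s1" "0 < s1 $ 2"
    using atom[of 0 1] unfolding P_def by auto
  obtain s2 where s2: "s2 \<in> R" "0 < P s2" "0 < side s2"
    using atom[of "sin \<alpha>" "- cos \<alpha>"] unfolding P_def side_def by auto
  obtain s3 where s3: "s3 \<in> R" "0 < P s3" "0 < (- s3) $ 2"
    using atom[of 0 "-1"] unfolding P_def by auto
  obtain s4 where s4: "s4 \<in> R" "0 < P s4" "0 < side (- s4)"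
    using atom[of "- sin \<alpha>" "cos \<alpha>"] unfolding P_def side_def by auto
  define p where "p = Min {P s1, P s2, P s3, P s4}"
  define t where "t = Min {s1 $ 2, side s2, (- s3) $ 2, side (- s4)}"
  define L where "L = norm s1 + norm s2 + norm s3 + norm s4 + 1"
  have p: "0 < p" "p \<le> P s1" "p \<le> P s2" "p \<le> P s3" "p \<le> P s4"
    unfolding p_def using s1 s2 s3 s4 by auto
  have t: "0 < t" "t \<le> s1 $ 2" "t \<le> side s2" "t \<le> (- s3) $ 2" "t \<le> side (- s4)"
    unfolding t_def using s1 s2 s3 s4 by auto
  have L: "0 < L" "norm s1 \<le> L" "norm s2 \<le> L" "norm s3 \<le> L" "norm s4 \<le> L"
    unfolding L_def by (simp_all add: add_nonneg_pos)
  \<comment> \<open>Beyond this norm the two signed distances add up to at least \<open>2 * (\<bar>A\<bar> + t + L)\<close>.\<close>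
  define far_from where "far_from A = 4 * (\<bar>A\<bar> + t + L) / sin \<alpha>" for A
  have move: "x + v \<in> wedge \<alpha> \<and> wall_dist \<alpha> x + t \<le> wall_dist \<alpha> (x + v)"
    if x: "x \<in> wedge \<alpha>" "far_from A \<le> norm x" "wall_dist \<alpha> x < A" and v: "norm v \<le> L"
      and dir: "x $ 2 \<le> side x \<and> t \<le> v $ 2 \<or> side x \<le> x $ 2 \<and> t \<le> side v" for A x v
  proof -
    have s: "0 < sin \<alpha>" using \<alpha> \<alpha>' by (intro sin_gt_zero)
    have "4 * (\<bar>A\<bar> + t + L) \<le> sin \<alpha> * norm x"
      using x(2) s unfolding far_from_def by (simp add: pos_divide_le_eq mult.commute)
    also have "\<dots> \<le> 2 * (x $ 2 + side x)"
      using norm_le_side_sum[OF \<alpha> x(1)] unfolding side_def .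
    finally have sum: "2 * (\<bar>A\<bar> + t + L) \<le> x $ 2 + side x" by simp
    have lin: "(x + v) $ 2 = x $ 2 + v $ 2" "side (x + v) = side x + side v"
      unfolding side_def by (simp_all add: algebra_simps)
    have bound: "\<bar>v $ 2\<bar> \<le> L" "\<bar>side v\<bar> \<le> L"
      using abs_snd_le_norm[of v] abs_side_le_norm[of \<alpha> v] v unfolding side_def by linarith+
    have "wall_dist \<alpha> x + t \<le> wall_dist \<alpha> (x + v)"
      using dir
    proof
      assume "x $ 2 \<le> side x \<and> t \<le> v $ 2"
      then show ?thesis using sum bound x(3) t(1) L(1) unfolding d lin by (smt (verit))
    next
      assume "side x \<le> x $ 2 \<and> t \<le> side v"
      then show ?thesis using sum bound x(3) t(1) L(1) unfolding d lin by (smt (verit))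
    qed
    then show ?thesis using x(1) t(1) unfolding wedge_eq_half_planes[OF \<alpha>(1) \<alpha>'] by auto
  qed
  have "layered_walk M X (wedge \<alpha>) R (wall_dist \<alpha>) p t L"
  proof (intro layered_walk.intro layered_walk_axioms.intro)
    show "prob_space M" by (rule prob_space_axioms)
    show "finite {x \<in> wedge \<alpha> \<inter> R. norm x < B}" for B
      by (rule finite_subset[OF _ lattice2_finite_ball[OF R(1), of B]]) auto
    show "0 \<le> wall_dist \<alpha> x" if "x \<in> wedge \<alpha> \<inter> R" for x
      using that unfolding wedge_eq_half_planes[OF \<alpha>(1) \<alpha>'] by auto
    show "\<exists>B. \<forall>x\<in>wedge \<alpha> \<inter> R. B \<le> norm x \<longrightarrow> wall_dist \<alpha> x < A \<longrightarrow>
        (\<exists>s. p \<le> prob {\<omega> \<in> space M. X \<omega> = s} \<and> norm s \<le> L \<and>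
             x + s \<in> wedge \<alpha> \<inter> R \<and> wall_dist \<alpha> x + t \<le> wall_dist \<alpha> (x + s))" for A
    proof (intro exI[of _ "far_from A"] ballI impI)
      fix x assume x: "x \<in> wedge \<alpha> \<inter> R" "far_from A \<le> norm x" "wall_dist \<alpha> x < A"
      define s where "s = (if x $ 2 \<le> side x then s1 else s2)"
      have "s \<in> R" "p \<le> P s" "norm s \<le> L" using s1 s2 p L unfolding s_def by auto
      moreover have "x + s \<in> wedge \<alpha> \<and> wall_dist \<alpha> x + t \<le> wall_dist \<alpha> (x + s)"
        using x t calculation(3) by (intro move[of x A s]) (auto simp: s_def)
      ultimately show "\<exists>s. p \<le> prob {\<omega> \<in> space M. X \<omega> = s} \<and> norm s \<le> L \<and>
             x + s \<in> wedge \<alpha> \<inter> R \<and> wall_dist \<alpha> x + t \<le> wall_dist \<alpha> (x + s)"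
        using x(1) lattice2_add_diff[OF R(1)] unfolding P_def by blast
    qed
    show "\<exists>B. \<forall>x\<in>wedge \<alpha> \<inter> R. B \<le> norm x \<longrightarrow> wall_dist \<alpha> x < A \<longrightarrow>
        (\<exists>s. p \<le> prob {\<omega> \<in> space M. X \<omega> = s} \<and> norm s \<le> L \<and>
             x - s \<in> wedge \<alpha> \<inter> R \<and> wall_dist \<alpha> x + t \<le> wall_dist \<alpha> (x - s))" for A
    proof (intro exI[of _ "far_from A"] ballI impI)
      fix x assume x: "x \<in> wedge \<alpha> \<inter> R" "far_from A \<le> norm x" "wall_dist \<alpha> x < A"
      define s where "s = (if x $ 2 \<le> side x then s3 else s4)"
      have "s \<in> R" "p \<le> P s" "norm s \<le> L" using s3 s4 p L unfolding s_def by auto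
      moreover have "x + (- s) \<in> wedge \<alpha> \<and> wall_dist \<alpha> x + t \<le> wall_dist \<alpha> (x + (- s))"
        using x t calculation(3) by (intro move[of x A "- s"]) (auto simp: s_def)
      ultimately show "\<exists>s. p \<le> prob {\<omega> \<in> space M. X \<omega> = s} \<and> norm s \<le> L \<and>
             x - s \<in> wedge \<alpha> \<inter> R \<and> wall_dist \<alpha> x + t \<le> wall_dist \<alpha> (x - s)"
        using x(1) lattice2_add_diff[OF R(1)] unfolding P_def by force
    qed
  qed (use p t L X wall_dist_lipschitz in auto)
  then show ?thesis by (rule that)
qed

lemma AE_of_equal_distr:
  assumes "X \<in> borel_measurable M" "Y \<in> borel_measurable M"
    and "distr M borel Y = distr M borel X"
    and P: "{z \<in> space borel. P z} \<in> sets borel" and "AE \<omega> in M. P (Y \<omega>)"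
  shows "AE \<omega> in M. P (X \<omega>)"
proof -
  have "AE z in distr M borel Y. P z"
    using assms(5) unfolding AE_distr_iff[OF assms(2) P] .
  then show ?thesis unfolding assms(3) AE_distr_iff[OF assms(1) P] .
qed

text \<open>
  A walk that is outside \<open>K\<close> at time 1 exits at time 1, and exits happen on the boundary. So it is the
  first step alone that carries the information on how the walk leaves \<open>K\<close>.
\<close>

lemma (in prob_space) first_step_in_closure:
  fixes X :: "'a \<Rightarrow> real^2"
  assumes [measurable]: "X \<in> borel_measurable M" "\<xi> 1 \<in> borel_measurable M"
    and distr: "distr M borel (\<xi> 1) = distr M borel X"
    and K: "open K" and R: "countable R"
    and walk: "AE \<omega> in M. \<forall>n. walk \<xi> n \<omega> \<in> R"
    and exit: "AE \<omega> in M. \<exists>n. exit_time K \<xi> x \<omega> = enat n \<and> x + walk \<xi> n \<omega> \<in> frontier K"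
  shows "AE \<omega> in M. X \<omega> \<in> R \<and> (x + X \<omega> \<in> K \<or> x + X \<omega> \<in> frontier K)"
proof -
  let ?P = "\<lambda>z. z \<in> R \<and> (x + z \<in> K \<or> x + z \<in> frontier K)"
  have [measurable]: "R \<in> sets borel" "K \<in> sets borel" "frontier K \<in> sets borel"
    using K sets.countable[OF _ R, of borel] by auto
  have P: "{z \<in> space borel. ?P z} \<in> sets borel" by measurable
  have "AE \<omega> in M. ?P (\<xi> 1 \<omega>)"
    using walk exit
  proof eventually_elim
    case (elim \<omega>)
    have one: "walk \<xi> 1 \<omega> = \<xi> 1 \<omega>" unfolding walk_def by simp
    have "x + \<xi> 1 \<omega> \<in> frontier K" if out: "x + \<xi> 1 \<omega> \<notin> K"
    proof -
      obtain n where n: "exit_time K \<xi> x \<omega> = enat n" "x + walk \<xi> n \<omega> \<in> frontier K"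
        using elim(2) by blast
      have "exit_time K \<xi> x \<omega> \<le> enat 1"
        unfolding exit_time_def using out one by (intro Inf_lower) auto
      moreover have "enat 1 \<le> exit_time K \<xi> x \<omega>"
        unfolding exit_time_def by (intro Inf_greatest) auto
      ultimately have "n = 1" using n(1) by simp
      then show ?thesis using n(2) one by simp
    qed
    moreover have "\<xi> 1 \<omega> \<in> R" using elim(1) one by metis
    ultimately show ?case by blast
  qed
  then show ?thesis by (rule AE_of_equal_distr[OF assms(1,2) distr P])
qed

lemma (in prob_space) integrable_polynomial_growth:
  fixes X :: "'a \<Rightarrow> real^2" and f :: "real^2 \<Rightarrow> real"
  assumes [measurable]: "X \<in> borel_measurable M" "f \<in> borel_measurable borel"
    and moment: "integrable M (\<lambda>\<omega>. norm (X \<omega>) ^ m)"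
    and bound: "\<And>z. \<bar>f z\<bar> \<le> C * (1 + norm z) ^ m" and C: "0 \<le> C"
  shows "integrable M (\<lambda>\<omega>. f (x + X \<omega>))"
proof (rule Bochner_Integration.integrable_bound)
  show "integrable M (\<lambda>\<omega>. C * (2 ^ m * ((1 + norm x) ^ m + norm (X \<omega>) ^ m)))"
    using moment by auto
  have "\<bar>f (x + z)\<bar> \<le> C * (2 ^ m * ((1 + norm x) ^ m + norm z ^ m))" for z
  proof -
    let ?b = "max (1 + norm x) (norm z)"
    have "1 + norm (x + z) \<le> 2 * ?b" using norm_triangle_ineq[of x z] by (simp add: max_def)
    then have "(1 + norm (x + z)) ^ m \<le> 2 ^ m * ?b ^ m"
      unfolding power_mult_distrib[symmetric] by (intro power_mono) auto
    also have "?b ^ m \<le> (1 + norm x) ^ m + norm z ^ m" by (simp add: max_def)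
    finally show ?thesis using bound[of "x + z"] C
      by (smt (verit, best) mult_left_mono zero_le_power)
  qed
  then show "AE \<omega> in M. norm (f (x + X \<omega>)) \<le> norm (C * (2 ^ m * ((1 + norm x) ^ m + norm (X \<omega>) ^ m)))"
    using C by simp
qed measurable

text \<open>
  The polynomial has the mean value property for the unrestricted walk, and vanishes at those points
  outside the wedge that can be reached in one step. Killing the walk thus removes nothing from
  the expectation.
\<close>

lemma (in prob_space) harmonic_polynomial_killed_harmonic:
  fixes X :: "'a \<Rightarrow> real^2"
  assumes X [measurable]: "X \<in> borel_measurable M" and m: "0 < m"
    and moment: "integrable M (\<lambda>\<omega>. norm (X \<omega>) ^ m)"
    and h: "harmonic_polynomial M X m h"
    and R: "lattice2 R"
    and step: "\<And>x. x \<in> wedge (pi / real m) \<inter> R \<Longrightarrow> AE \<omega> in M. X \<omega> \<in> R \<and>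
        (x + X \<omega> \<in> wedge (pi / real m) \<or> x + X \<omega> \<in> frontier (wedge (pi / real m)))"
    and K: "open (wedge (pi / real m))"
  shows "killed_harmonic M X (wedge (pi / real m)) R h"
  unfolding killed_harmonic_def
proof
  let ?K = "wedge (pi / real m)"
  obtain r where r: "poly2_deg_le (m - 1) r" "\<And>x. h x = wedge_harmonic m x + r x"
    using h unfolding harmonic_polynomial_def by blast
  have mean: "(\<integral>\<omega>. h (x + X \<omega>) \<partial>M) = h x" for x
    using h unfolding harmonic_polynomial_def by blast
  have zero: "h x = 0" if "x \<in> frontier ?K" for x
    using h that unfolding harmonic_polynomial_def by blast
  have h_eq: "h = (\<lambda>x. wedge_harmonic m x + r x)" using r(2) by blast
  have h_meas [measurable]: "h \<in> borel_measurable borel"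
    unfolding h_eq by (intro borel_measurable_continuous_onI continuous_on_add
      continuous_wedge_harmonic continuous_poly2[OF r(1)])
  obtain C where C: "0 \<le> C" "\<And>x. \<bar>r x\<bar> \<le> C * (1 + norm x) ^ (m - 1)"
    using poly2_bound[OF r(1)] by blast
  have h_bound: "\<bar>h x\<bar> \<le> (1 + C) * (1 + norm x) ^ m" for x
  proof -
    have "\<bar>h x\<bar> \<le> norm x ^ m + C * (1 + norm x) ^ (m - 1)"
      using abs_wedge_harmonic_le[of m x] C(2)[of x] unfolding r(2) by linarith
    also have "\<dots> \<le> (1 + norm x) ^ m + C * (1 + norm x) ^ m"
      using C(1) by (intro add_mono power_mono mult_left_mono power_increasing) auto
    finally show ?thesis by (simp add: algebra_simps)
  qed
  have [measurable]: "?K \<inter> R \<in> sets borel"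
    using K sets.countable[OF _ countable_lattice2[OF R], of borel] by auto
  fix x assume x: "x \<in> ?K \<inter> R"
  have int: "integrable M (\<lambda>\<omega>. h (x + X \<omega>))"
    by (rule integrable_polynomial_growth[OF X h_meas moment h_bound]) (use C in simp)
  have eq: "AE \<omega> in M. h (x + X \<omega>) = indicat_real (?K \<inter> R) (x + X \<omega>) * h (x + X \<omega>)"
    using step[OF x]
  proof eventually_elim
    case (elim \<omega>)
    have "x + X \<omega> \<in> R" using elim x lattice2_add_diff(1)[OF R] by blast
    then show ?case using elim zero by (auto simp: indicator_def)
  qed
  have "integrable M (\<lambda>\<omega>. indicat_real (?K \<inter> R) (x + X \<omega>) * h (x + X \<omega>))"
    using int eq by (subst integrable_cong_AE[symmetric, where f = "\<lambda>\<omega>. h (x + X \<omega>)"]) auto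
  moreover have "(\<integral>\<omega>. h (x + X \<omega>) \<partial>M) = (\<integral>\<omega>. indicat_real (?K \<inter> R) (x + X \<omega>) * h (x + X \<omega>) \<partial>M)"
    using eq by (intro integral_cong_AE) auto
  ultimately show "integrable M (\<lambda>\<omega>. indicat_real (?K \<inter> R) (x + X \<omega>) * h (x + X \<omega>)) \<and>
      h x = (\<integral>\<omega>. indicat_real (?K \<inter> R) (x + X \<omega>) * h (x + X \<omega>) \<partial>M)"
    using mean by simp
qed

lemma killed_harmonic_diff:
  assumes "killed_harmonic M X K R f" "killed_harmonic M X K R g"
  shows "killed_harmonic M X K R (\<lambda>x. f x - g x)"
  using assms unfolding killed_harmonic_def by (simp add: right_diff_distrib)

section \<open>Identification of the harmonic polynomial\<close>

text \<open>
  The limit along the distance to the boundary, multiplied out and expressed by the explicit depth.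
\<close>

lemma eventually_deep_in_wedge:
  assumes lim: "((\<lambda>x. V x / wedge_harmonic m x) \<longlongrightarrow> 1)
      (inf (filtercomap (\<lambda>x. infdist x (frontier (wedge (pi / real m)))) at_top)
           (principal (wedge (pi / real m) \<inter> R)))"
    and m: "2 \<le> m" and e: "0 < e"
  shows "\<exists>A. \<forall>x\<in>wedge (pi / real m) \<inter> R. A \<le> wall_dist (pi / real m) x \<longrightarrow>
           \<bar>V x - wedge_harmonic m x\<bar> \<le> e * wedge_harmonic m x"
proof -
  let ?K = "wedge (pi / real m)"
  have \<alpha>: "0 < pi / real m" "pi / real m < pi" using m by (auto simp: field_simps)
  have "eventually (\<lambda>x. dist (V x / wedge_harmonic m x) 1 < e)
      (inf (filtercomap (\<lambda>x. infdist x (frontier ?K)) at_top) (principal (?K \<inter> R)))"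
    using tendstoD[OF lim e] .
  then obtain A where A: "\<And>x. x \<in> ?K \<inter> R \<Longrightarrow> A \<le> infdist x (frontier ?K) \<Longrightarrow>
      dist (V x / wedge_harmonic m x) 1 < e"
    unfolding eventually_inf_principal eventually_filtercomap eventually_at_top_linorder by blast
  have "\<bar>V x - wedge_harmonic m x\<bar> \<le> e * wedge_harmonic m x"
    if x: "x \<in> ?K \<inter> R" "A \<le> wall_dist (pi / real m) x" for x
  proof -
    have d: "0 < wall_dist (pi / real m) x"
      using x(1) wedge_eq_half_planes[OF \<alpha>] by auto
    then have "x \<noteq> 0" unfolding wall_dist_def by auto
    then have "0 < wall_dist (pi / real m) x * norm x ^ (m - 1)" using d by simp
    then have u: "0 < wedge_harmonic m x"
      using wedge_harmonic_bounds(1)[of m x] x(1) m by auto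
    have "\<bar>V x / wedge_harmonic m x - 1\<bar> \<le> e"
      using A[OF x(1)] wall_dist_le_infdist_frontier[OF \<alpha>, of x] x by (auto simp: dist_real_def)
    then have "\<bar>V x / wedge_harmonic m x - 1\<bar> * wedge_harmonic m x \<le> e * wedge_harmonic m x"
      using u by (intro mult_right_mono) auto
    moreover have "\<bar>V x / wedge_harmonic m x - 1\<bar> * wedge_harmonic m x = \<bar>V x - wedge_harmonic m x\<bar>"
    proof -
      have "V x - wedge_harmonic m x = (V x / wedge_harmonic m x - 1) * wedge_harmonic m x"
        using u by (simp add: left_diff_distrib)
      then show ?thesis using u by (simp add: abs_mult)
    qed
    ultimately show ?thesis by simp
  qed
  then show ?thesis by blast
qed

theorem theorem3:
  fixes M :: "'a measure" and X :: "'a \<Rightarrow> real^2" and \<xi> :: "nat \<Rightarrow> 'a \<Rightarrow> real^2"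
    and m :: nat and R :: "(real^2) set" and h V :: "real^2 \<Rightarrow> real"
  assumes "prob_space M"
    and "m \<ge> 2"
    and "X \<in> borel_measurable M"
    and "\<And>i. (\<integral>\<omega>. X \<omega> $ i \<partial>M) = 0"
    and "\<And>i j. (\<integral>\<omega>. X \<omega> $ i * X \<omega> $ j \<partial>M) = (if i = j then 1 else 0)"
    and "integrable M (\<lambda>\<omega>. norm (X \<omega>) ^ m)"
    and "prob_space.indep_vars M (\<lambda>_. borel) \<xi> {1..}"
    and "\<And>k. k \<ge> 1 \<Longrightarrow> distr M borel (\<xi> k) = distr M borel X"
    and "lattice2 R"
    and "AE \<omega> in M. \<forall>n. walk \<xi> n \<omega> \<in> R"
    and "\<And>x. x \<in> R \<inter> wedge (pi / real m) \<Longrightarrow>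
           AE \<omega> in M. \<exists>n. exit_time (wedge (pi / real m)) \<xi> x \<omega> = enat n \<and>
                          x + walk \<xi> n \<omega> \<in> frontier (wedge (pi / real m))"
    and "harmonic_polynomial M X m h"
    and "killed_walk_V M X \<xi> m R V"
  shows "(\<forall>x \<in> wedge (pi / real m) \<inter> R. h x = V x) \<and>
         (\<forall>x \<in> wedge (pi / real m) \<inter> R. h x \<ge> 0)"
proof -
  interpret prob_space M by fact
  define K where "K = wedge (pi / real m)"
  define d where "d = wall_dist (pi / real m)"
  define u where "u = wedge_harmonic m"
  define n where "n = m - 1"
  have m: "0 < m" "0 < n" using assms(2) unfolding n_def by auto
  have \<alpha>: "0 < pi / real m" "pi / real m \<le> pi / 2" "pi / real m < pi"
    using assms(2) by (auto simp: field_simps)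
  have K: "open K" unfolding K_def by (rule open_wedge[OF \<alpha>(1,3)])
  have V0: "0 \<le> V x" if "x \<in> K \<inter> R" for x
    using assms(13) that unfolding killed_walk_V_def K_def Let_def by blast
  have V_harm: "killed_harmonic M X K R V"
    using assms(13) unfolding killed_walk_V_def K_def Let_def by blast
  have V_deep: "\<exists>A. \<forall>x\<in>K \<inter> R. A \<le> d x \<longrightarrow> \<bar>V x - u x\<bar> \<le> e * u x" if "0 < e" for e
    using assms(13) eventually_deep_in_wedge[OF _ assms(2) that]
    unfolding killed_walk_V_def K_def Let_def d_def u_def by blast

  have \<xi>1: "\<xi> 1 \<in> borel_measurable M"
    using assms(7) unfolding indep_vars_def by auto
  have step: "AE \<omega> in M. X \<omega> \<in> R \<and> (x + X \<omega> \<in> K \<or> x + X \<omega> \<in> frontier K)" if "x \<in> K \<inter> R" for x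
    using that assms(8)[of 1] assms(11)[of x] unfolding K_def
    by (intro first_step_in_closure[OF assms(3) \<xi>1 _ K[unfolded K_def] countable_lattice2[OF assms(9)] assms(10)]) auto
  have h_harm: "killed_harmonic M X K R h"
    using step unfolding K_def
    by (intro harmonic_polynomial_killed_harmonic[OF assms(3) m(1) assms(6,12,9) _ K[unfolded K_def]])

  have X_R: "AE \<omega> in M. X \<omega> \<in> R"
  proof -
    have R_meas: "{z \<in> space borel. z \<in> R} \<in> sets borel"
      using sets.countable[OF _ countable_lattice2[OF assms(9)], of borel] by simp
    have "AE \<omega> in M. \<xi> 1 \<omega> \<in> R"
      using assms(10)
    proof eventually_elim
      case (elim \<omega>)
      then have "walk \<xi> 1 \<omega> \<in> R" by blast
      then show ?case unfolding walk_def by simp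
    qed
    then show ?thesis
      by (rule AE_of_equal_distr[OF assms(3) \<xi>1 assms(8)[OF order_refl] R_meas])
  qed
  obtain p t L where "layered_walk M X K R d p t L"
    using inward_steps[OF assms(3,4,5,9) X_R \<alpha>(1,2)] unfolding K_def d_def by blast
  then interpret layered_walk M X K R d p t L .
  obtain s where "0 < prob {\<omega> \<in> space M. X \<omega> = s}" "0 < s $ 2"
    using atom_in_half_plane[OF assms(3,4,5) countable_lattice2[OF assms(9)] X_R, of 0 1] by auto
  then have s: "s \<noteq> 0" "0 < prob {\<omega> \<in> space M. X \<omega> = s}" by auto

  obtain r C where r: "\<And>x. h x = u x + r x" and C: "0 \<le> C" "\<And>x. \<bar>r x\<bar> \<le> C * (1 + norm x) ^ n"
    using assms(12) poly2_bound[of n] unfolding harmonic_polynomial_def u_def n_def by metis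
  define C' where "C' = C * 2 ^ n"
  have C': "0 \<le> C'" unfolding C'_def using C(1) by simp
  have r_bound: "\<bar>r x\<bar> \<le> C' * norm x ^ n" if "1 \<le> norm x" for x
  proof -
    have "(1 + norm x) ^ n \<le> (2 * norm x) ^ n" using that by (intro power_mono) auto
    then have "C * (1 + norm x) ^ n \<le> C * (2 ^ n * norm x ^ n)"
      using C(1) by (intro mult_left_mono) (auto simp: power_mult_distrib)
    then show ?thesis using C(2)[of x] unfolding C'_def by (simp add: mult.assoc)
  qed
  have u_bounds: "d x * norm x ^ n \<le> u x" "u x \<le> real m * (d x * norm x ^ n)" if "x \<in> K \<inter> R" for x
    using wedge_harmonic_bounds[OF m(1), of x] that unfolding K_def d_def u_def n_def by auto
  have u_nonneg: "0 \<le> u x" if "x \<in> K \<inter> R" for x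
    using u_bounds(1)[OF that] d_nonneg[OF that]
    by (meson mult_nonneg_nonneg norm_ge_zero order_trans zero_le_power)
  obtain A where A: "\<And>x. x \<in> K \<inter> R \<Longrightarrow> A \<le> d x \<Longrightarrow> \<bar>V x - u x\<bar> \<le> 1 / 2 * u x"
    using V_deep[of "1 / 2"] by auto

  have V_lower: "1 / 4 * growth n x \<le> V x" if x: "x \<in> K \<inter> R" "max 1 A \<le> d x" for x
  proof -
    have "growth n x \<le> 2 * (d x * norm x ^ n)"
    proof -
      have "1 * norm x ^ n \<le> d x * norm x ^ n" using x(2) by (intro mult_right_mono) auto
      then show ?thesis unfolding growth_def by (simp add: algebra_simps)
    qed
    moreover have "\<bar>V x - u x\<bar> \<le> 1 / 2 * u x" using A[OF x(1)] x(2) by simp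
    then have "u x \<le> 2 * V x" by linarith
    ultimately have "growth n x \<le> 4 * V x" using u_bounds(1)[OF x(1)] by linarith
    then show ?thesis by simp
  qed
  have V_upper: "1 / (2 * real m) * V x \<le> growth n x" if x: "x \<in> K \<inter> R" "max 1 A \<le> d x" for x
  proof -
    note u0 = u_nonneg[OF x(1)]
    have "\<bar>V x - u x\<bar> \<le> 1 / 2 * u x" using A[OF x(1)] x(2) by simp
    then have "V x \<le> 2 * u x" using u0 by linarith
    also have "\<dots> \<le> 2 * (real m * (d x * norm x ^ n))" using u_bounds(2)[OF x(1)] by simp
    also have "\<dots> \<le> 2 * (real m * growth n x)"
      unfolding growth_def by (intro mult_left_mono mult_right_mono) auto
    finally show ?thesis using m(1) by (simp add: field_simps)
  qed

  define D where "D x = h x - V x" for x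
  have D_harm: "killed_harmonic M X K R D"
    unfolding D_def by (rule killed_harmonic_diff[OF h_harm V_harm])
  have D_deep: "\<exists>A. eventually (\<lambda>x. A \<le> d x \<longrightarrow> \<bar>D x\<bar> \<le> e * V x) far" if e: "0 < e" for e
  proof -
    \<comment> \<open>Both \<open>\<bar>V - u\<bar>\<close> and \<open>\<bar>r\<bar>\<close> will be at most \<open>e' * u\<close>, and \<open>u \<le> 2 * V\<close>.\<close>
    define e' where "e' = min (1 / 2) (e / 4)"
    have e': "0 < e'" "e' \<le> 1 / 2" "4 * e' \<le> e" unfolding e'_def using e by auto
    obtain A' where A': "\<And>x. x \<in> K \<inter> R \<Longrightarrow> A' \<le> d x \<Longrightarrow> \<bar>V x - u x\<bar> \<le> e' * u x"
      using V_deep[OF e'(1)] by auto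
    have "\<bar>D x\<bar> \<le> e * V x"
      if x: "x \<in> K \<inter> R" "1 \<le> norm x" "max A' (C' / e') \<le> d x" for x
    proof -
      note u0 = u_nonneg[OF x(1)]
      have "C' \<le> e' * d x" using x(3) e'(1) by (simp add: pos_divide_le_eq mult.commute)
      then have "C' * norm x ^ n \<le> e' * d x * norm x ^ n" by (intro mult_right_mono) auto
      also have "\<dots> \<le> e' * u x" using u_bounds(1)[OF x(1)] e'(1) by (simp add: mult.assoc)
      finally have r': "\<bar>r x\<bar> \<le> e' * u x" using r_bound[OF x(2)] by linarith
      have V': "\<bar>V x - u x\<bar> \<le> e' * u x" using A'[OF x(1)] x(3) by simp
      have "e' * u x \<le> 1 / 2 * u x" using e'(2) u0 by (intro mult_right_mono)
      then have "u x \<le> 2 * V x" using V' by linarith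
      have "\<bar>D x\<bar> \<le> 2 * (e' * u x)" using r' V' unfolding D_def r by linarith
      also have "e' * u x \<le> e' * (2 * V x)" using \<open>u x \<le> 2 * V x\<close> e'(1) by (intro mult_left_mono) auto
      then have "2 * (e' * u x) \<le> 4 * e' * V x" by simp
      also have "\<dots> \<le> e * V x" using e'(3) V0[OF x(1)] by (intro mult_right_mono)
      finally show ?thesis .
    qed
    then show ?thesis unfolding eventually_far by blast
  qed
  have D_growth: "\<bar>D x\<bar> \<le> (real m + C') * growth n x + V x" if x: "x \<in> K \<inter> R" "1 \<le> norm x" for x
  proof -
    note u0 = u_nonneg[OF x(1)]
    have "d x * norm x ^ n \<le> growth n x" "norm x ^ n \<le> growth n x"
      using d_nonneg[OF x(1)] unfolding growth_def by (simp_all add: distrib_right)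
    then have "real m * (d x * norm x ^ n) \<le> real m * growth n x" "C' * norm x ^ n \<le> C' * growth n x"
      using C' by (auto intro: mult_left_mono)
    then show ?thesis
      using u0 u_bounds(2)[OF x(1)] r_bound[OF x(2)] V0[OF x(1)] unfolding D_def r
      by (simp add: distrib_right abs_le_iff)
  qed
  have "D x = 0" if "x \<in> K \<inter> R" for x
  proof (rule harmonic_eq_zero_of_growth[OF V_harm V0 D_harm m(2) _ _ _ _ D_deep _ s that])
    show "eventually (\<lambda>x. max 1 A \<le> d x \<longrightarrow> 1 / 4 * growth n x \<le> V x) far"
      using V_lower unfolding eventually_far by blast
    show "eventually (\<lambda>x. max 1 A \<le> d x \<longrightarrow> 1 / (2 * real m) * V x \<le> growth n x) far"
      using V_upper unfolding eventually_far by blast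
    show "eventually (\<lambda>x. \<bar>D x\<bar> \<le> (real m + C') * growth n x + V x) far"
      using D_growth unfolding eventually_far by blast
  qed (use m in auto)
  then show ?thesis using V0 unfolding D_def K_def by auto
qed

end
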